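(* Let $G$ be a connected, locally finite metric graph and let $\varepsilon>0$, $k,m\ge 0$. If $G$ is $\varepsilon$-densely $(k,m)$-path-chordal, then $G$ is $\delta$-hyperbolic for some $\delta\ge 0$; moreover $\delta(G)\le \max\{\frac{k}{4},\varepsilon+m\}$.
   Context: A metric graph is a graph $G$ in which every edge $e$ is regarded as isometric to an interval $[0,l_e]$ (no restriction on the lengths); interior points of edges are points of $G$, and $d(x,y)$ is the length of a shortest path joining $x,y$; this is a geodesic metric space. A geodesic triangle $T=\{x_1,x_2,x_3\}$ is the union of three geodesics $[x_1x_2],[x_2x_3],[x_3x_1]$; it is $\delta$-thin if each side lies in the $\delta$-neighborhood of the union of the other two. $G$ is $\delta$-hyperbolic if every geodesic triangle is $\delta$-thin, and $\delta(G)=\inf\{\delta: \text{every geodesic triangle of } G \text{ is } \delta\text{-thin}\}$. A cycle is a simple closed curve in $G$ (closed path through vertices all distinct except first and last); $d_C$ is the length metric on a cycle $C$ and $L(\cdot)$ is length. A shortcut in a cycle $C$ is a path $\sigma$ joining two vertices $p,q$ of $C$ with $L(\sigma)<d_C(p,q)$; it is strict if $\sigma\cap C=\{p,q\}$, and then $p,q$ are the shortcut vertices associated to $\sigma$. A subset $A$ of a metric space $X$ is $\varepsilon$-dense if every $x\in X$ has some $a\in A$ with $d(a,x)<\varepsilon$. $G$ is $\varepsilon$-densely $(k,m)$-path-chordal if for every cycle $C$ with $L(C)\ge k$ there exist strict shortcuts $\sigma_1,\dots,\sigma_r$ of $C$ with $L(\sigma_i)\le m$ whose associated shortcut vertices form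 an $\varepsilon$-dense subset of $(C,d_C)$. *)

theory Defs
  imports Complex_Main "HOL-Library.Extended_Real"
begin

text \<open>
  Graphs may have loops and multiple edges. The orientation of an edge from \<open>tail\<close> to \<open>head\<close> has
  no geometric meaning: it only fixes the identification of the edge \<open>e\<close> with \<open>[0, len e]\<close>.
\<close>

record ('v, 'e) mgraph =
  verts :: "'v set"
  edges :: "'e set"
  tail :: "'e \<Rightarrow> 'v"
  head :: "'e \<Rightarrow> 'v"
  len :: "'e \<Rightarrow> real"

definition metric_graph :: "('v, 'e) mgraph \<Rightarrow> bool" where
  "metric_graph G \<longleftrightarrow>
     (\<forall>e \<in> edges G. tail G e \<in> verts G \<and> head G e \<in> verts G \<and> 0 < len G e)"

definition locally_finite :: "('v, 'e) mgraph \<Rightarrow> bool" where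
  "locally_finite G \<longleftrightarrow> (\<forall>v \<in> verts G. finite {e \<in> edges G. tail G e = v \<or> head G e = v})"

datatype ('v, 'e) point = Vertex 'v | Inner 'e real

definition points :: "('v, 'e) mgraph \<Rightarrow> ('v, 'e) point set" where
  "points G = Vertex ` verts G \<union> {Inner e t | e t. e \<in> edges G \<and> 0 < t \<and> t < len G e}"

definition edge_point :: "('v, 'e) mgraph \<Rightarrow> 'e \<Rightarrow> real \<Rightarrow> ('v, 'e) point" where
  "edge_point G e t =
     (if t = 0 then Vertex (tail G e) else if t = len G e then Vertex (head G e) else Inner e t)"

text \<open>
  A path is a finite concatenation of segments; the segment \<open>(e, s, t)\<close> runs along the edge \<open>e\<close>
  from the point with parameter \<open>s\<close> to the point with parameter \<open>t\<close>, in either direction. The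
  empty list is the constant path.
\<close>

type_synonym 'e segment = "'e \<times> real \<times> real"

fun is_path :: "('v, 'e) mgraph \<Rightarrow> ('v, 'e) point \<Rightarrow> 'e segment list \<Rightarrow> ('v, 'e) point \<Rightarrow> bool" where
  "is_path G x [] y \<longleftrightarrow> x \<in> points G \<and> x = y"
| "is_path G x ((e, s, t) # \<sigma>) y \<longleftrightarrow>
     e \<in> edges G \<and> s \<in> {0..len G e} \<and> t \<in> {0..len G e} \<and>
     edge_point G e s = x \<and> is_path G (edge_point G e t) \<sigma> y"

definition path_length :: "'e segment list \<Rightarrow> real" where
  "path_length \<sigma> = (\<Sum>(e, s, t) \<leftarrow> \<sigma>. \<bar>t - s\<bar>)"

definition segment_trace :: "('v, 'e) mgraph \<Rightarrow> 'e segment \<Rightarrow> ('v, 'e) point set" where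
  "segment_trace G = (\<lambda>(e, s, t). edge_point G e ` {min s t..max s t})"

text \<open>The initial point \<open>x\<close> is only needed for the trace of the constant path.\<close>

definition path_trace :: "('v, 'e) mgraph \<Rightarrow> ('v, 'e) point \<Rightarrow> 'e segment list \<Rightarrow> ('v, 'e) point set" where
  "path_trace G x \<sigma> = insert x (\<Union>(segment_trace G ` set \<sigma>))"

definition connected_graph :: "('v, 'e) mgraph \<Rightarrow> bool" where
  "connected_graph G \<longleftrightarrow>
     verts G \<noteq> {} \<and> (\<forall>u \<in> verts G. \<forall>v \<in> verts G. \<exists>\<sigma>. is_path G (Vertex u) \<sigma> (Vertex v))"

text \<open>The length metric on a subset \<open>A\<close>; meaningful only for points joined by a path inside \<open>A\<close>.\<close>

definition length_dist ::
    "('v, 'e) mgraph \<Rightarrow> ('v, 'e) point set \<Rightarrow> ('v, 'e) point \<Rightarrow> ('v, 'e) point \<Rightarrow> real" where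
  "length_dist G A x y = Inf {path_length \<sigma> | \<sigma>. is_path G x \<sigma> y \<and> path_trace G x \<sigma> \<subseteq> A}"

definition graph_dist :: "('v, 'e) mgraph \<Rightarrow> ('v, 'e) point \<Rightarrow> ('v, 'e) point \<Rightarrow> real" where
  "graph_dist G = length_dist G (points G)"

definition geodesic ::
    "('v, 'e) mgraph \<Rightarrow> ('v, 'e) point \<Rightarrow> ('v, 'e) point \<Rightarrow> ('v, 'e) point set \<Rightarrow> bool" where
  "geodesic G x y S \<longleftrightarrow>
     (\<exists>\<gamma> l. 0 \<le> l \<and> \<gamma> 0 = x \<and> \<gamma> l = y \<and> S = \<gamma> ` {0..l} \<and> S \<subseteq> points G \<and>
        (\<forall>s \<in> {0..l}. \<forall>t \<in> {0..l}. graph_dist G (\<gamma> s) (\<gamma> t) = \<bar>s - t\<bar>))"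

definition geodesic_triangle ::
    "('v, 'e) mgraph \<Rightarrow> ('v, 'e) point set \<Rightarrow> ('v, 'e) point set \<Rightarrow> ('v, 'e) point set \<Rightarrow> bool" where
  "geodesic_triangle G A B C \<longleftrightarrow>
     (\<exists>x1 x2 x3. geodesic G x1 x2 A \<and> geodesic G x2 x3 B \<and> geodesic G x3 x1 C)"

definition neighborhood :: "('v, 'e) mgraph \<Rightarrow> real \<Rightarrow> ('v, 'e) point set \<Rightarrow> ('v, 'e) point set" where
  "neighborhood G \<delta> A = {z \<in> points G. \<exists>a \<in> A. graph_dist G z a \<le> \<delta>}"

definition thin ::
    "('v, 'e) mgraph \<Rightarrow> real \<Rightarrow> ('v, 'e) point set \<Rightarrow> ('v, 'e) point set \<Rightarrow> ('v, 'e) point set \<Rightarrow> bool" where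
  "thin G \<delta> A B C \<longleftrightarrow>
     A \<subseteq> neighborhood G \<delta> (B \<union> C) \<and>
     B \<subseteq> neighborhood G \<delta> (C \<union> A) \<and>
     C \<subseteq> neighborhood G \<delta> (A \<union> B)"

definition hyperbolic :: "('v, 'e) mgraph \<Rightarrow> real \<Rightarrow> bool" where
  "hyperbolic G \<delta> \<longleftrightarrow> (\<forall>A B C. geodesic_triangle G A B C \<longrightarrow> thin G \<delta> A B C)"

text \<open>Extended-real valued, so that it is \<open>\<infinity>\<close> if \<open>G\<close> is not hyperbolic.\<close>

definition hyperbolicity_constant :: "('v, 'e) mgraph \<Rightarrow> ereal" where
  "hyperbolicity_constant G = Inf (ereal ` {\<delta>. hyperbolic G \<delta>})"

text \<open>
  A cycle traverses full edges. Distinctness of the edges only matters for cycles with two edges,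
  where it excludes running back and forth along a single edge; a loop is a cycle with one edge.
\<close>

definition is_cycle :: "('v, 'e) mgraph \<Rightarrow> 'e segment list \<Rightarrow> bool" where
  "is_cycle G c \<longleftrightarrow>
     c \<noteq> [] \<and> (\<exists>x. is_path G x c x) \<and>
     (\<forall>(e, s, t) \<in> set c. {s, t} = {0, len G e}) \<and>
     distinct (map (\<lambda>(e, s, t). edge_point G e s) c) \<and>
     distinct (map fst c)"

definition cycle_trace :: "('v, 'e) mgraph \<Rightarrow> 'e segment list \<Rightarrow> ('v, 'e) point set" where
  "cycle_trace G c = \<Union>(segment_trace G ` set c)"

definition cycle_dist ::
    "('v, 'e) mgraph \<Rightarrow> 'e segment list \<Rightarrow> ('v, 'e) point \<Rightarrow> ('v, 'e) point \<Rightarrow> real" where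
  "cycle_dist G c = length_dist G (cycle_trace G c)"

definition shortcut ::
    "('v, 'e) mgraph \<Rightarrow> 'e segment list \<Rightarrow> ('v, 'e) point \<Rightarrow> 'e segment list \<Rightarrow> ('v, 'e) point \<Rightarrow> bool" where
  "shortcut G c p \<sigma> q \<longleftrightarrow>
     p \<in> Vertex ` verts G \<inter> cycle_trace G c \<and> q \<in> Vertex ` verts G \<inter> cycle_trace G c \<and>
     is_path G p \<sigma> q \<and> path_length \<sigma> < cycle_dist G c p q"

definition strict_shortcut ::
    "('v, 'e) mgraph \<Rightarrow> 'e segment list \<Rightarrow> ('v, 'e) point \<Rightarrow> 'e segment list \<Rightarrow> ('v, 'e) point \<Rightarrow> bool" where
  "strict_shortcut G c p \<sigma> q \<longleftrightarrow>
     shortcut G c p \<sigma> q \<and> path_trace G p \<sigma> \<inter> cycle_trace G c = {p, q}"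

definition eps_dense :: "('a \<Rightarrow> 'a \<Rightarrow> real) \<Rightarrow> real \<Rightarrow> 'a set \<Rightarrow> 'a set \<Rightarrow> bool" where
  "eps_dense d \<epsilon> A X \<longleftrightarrow> A \<subseteq> X \<and> (\<forall>x \<in> X. \<exists>a \<in> A. d a x < \<epsilon>)"

definition densely_path_chordal :: "('v, 'e) mgraph \<Rightarrow> real \<Rightarrow> real \<Rightarrow> real \<Rightarrow> bool" where
  "densely_path_chordal G \<epsilon> k m \<longleftrightarrow>
     (\<forall>c. is_cycle G c \<and> k \<le> path_length c \<longrightarrow>
        (\<exists>S. finite S \<and>
           (\<forall>(p, \<sigma>, q) \<in> S. strict_shortcut G c p \<sigma> q \<and> path_length \<sigma> \<le> m) \<and>
           eps_dense (cycle_dist G c) \<epsilon> (\<Union>(p, \<sigma>, q) \<in> S. {p, q}) (cycle_trace G c)))"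

end

theory Submission
  imports Defs
begin

text \<open>
  Let \<open>x\<close> lie on a side \<open>A\<close> of a geodesic triangle but not on the union \<open>B \<union> C\<close> of the other two.
  Follow \<open>A\<close> from \<open>x\<close> in both directions up to the first points \<open>a\<close>, \<open>b\<close> of \<open>B \<union> C\<close>, then follow the
  side containing \<open>a\<close> towards the vertex opposite to \<open>A\<close> up to the first point \<open>c\<close> on the side
  containing \<open>b\<close>. The three arcs between \<open>a\<close>, \<open>b\<close> and \<open>c\<close> form a cycle, and its arc \<open>[ab]\<close> on \<open>A\<close> is a
  geodesic, so it has at most half of the length of the cycle. If the cycle is shorter than \<open>k\<close>,
  then \<open>x\<close> is within \<open>k / 4\<close> of \<open>a\<close> or \<open>b\<close>. Otherwise a shortcut vertex is within \<open>\<epsilon>\<close> of \<open>x\<close>, and since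
  a shortcut cannot have both ends on the geodesic arc \<open>[ab]\<close>, one of its ends is on \<open>B \<union> C\<close>, within
  \<open>\<epsilon> + m\<close> of \<open>x\<close>. Local finiteness enters because geodesics are isometric embeddings, which have to
  be written as finite concatenations of segments of edges.
\<close>

subsection \<open>Paths as lists of segments\<close>

lemma path_length_simps [simp]:
  "path_length [] = 0"
  "path_length ((e, s, t) # \<sigma>) = \<bar>t - s\<bar> + path_length \<sigma>"
  "path_length (\<sigma> @ \<tau>) = path_length \<sigma> + path_length \<tau>"
  by (simp_all add: path_length_def)

lemma path_length_nonneg: "0 \<le> path_length \<sigma>"
  by (induction \<sigma>) auto

text \<open>The final point of a segment is left out, so that a closed path is simple iff the half-open
  traces of its segments are pairwise disjoint.\<close>

definition half_trace :: "('v, 'e) mgraph \<Rightarrow> 'e segment \<Rightarrow> ('v, 'e) point set" where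
  "half_trace G = (\<lambda>(e, s, t). edge_point G e ` ({min s t..max s t} - {t}))"

definition half_traces :: "('v, 'e) mgraph \<Rightarrow> 'e segment list \<Rightarrow> ('v, 'e) point set" where
  "half_traces G \<sigma> = \<Union>(half_trace G ` set \<sigma>)"

text \<open>\<open>half_trace\<close> drops the end parameter, not the end point, so a full loop
  keeps its vertex. The final point of the whole path is never tested, which allows a return to the
  start.\<close>

definition simple_path :: "('v, 'e) mgraph \<Rightarrow> 'e segment list \<Rightarrow> bool" where
  "simple_path G \<sigma> \<longleftrightarrow>
     (\<forall>(e, s, t) \<in> set \<sigma>. s \<noteq> t) \<and> sorted_wrt (\<lambda>a b. half_trace G a \<inter> half_trace G b = {}) \<sigma>"

lemma half_traces_simps [simp]:
  "half_traces G [] = {}"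
  "half_traces G (a # \<sigma>) = half_trace G a \<union> half_traces G \<sigma>"
  "half_traces G (\<sigma> @ \<tau>) = half_traces G \<sigma> \<union> half_traces G \<tau>"
  by (auto simp: half_traces_def)

lemma simple_path_Nil [simp]: "simple_path G []"
  by (simp add: simple_path_def)

lemma simple_path_append:
  "simple_path G (\<sigma> @ \<tau>) \<longleftrightarrow>
     simple_path G \<sigma> \<and> simple_path G \<tau> \<and> half_traces G \<sigma> \<inter> half_traces G \<tau> = {}"
  by (auto simp: simple_path_def sorted_wrt_append half_traces_def; blast)

lemma simple_path_Cons:
  "simple_path G ((e, s, t) # \<sigma>) \<longleftrightarrow>
     s \<noteq> t \<and> simple_path G \<sigma> \<and> half_trace G (e, s, t) \<inter> half_traces G \<sigma> = {}"
  by (auto simp: simple_path_def half_traces_def; blast)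

lemma segment_trace_eq_half_trace:
  "segment_trace G (e, s, t) = insert (edge_point G e t) (half_trace G (e, s, t))"
  by (auto simp: segment_trace_def half_trace_def)

lemma path_trace_Cons:
  "edge_point G e s = x \<Longrightarrow>
     path_trace G x ((e, s, t) # \<sigma>) = segment_trace G (e, s, t) \<union> path_trace G (edge_point G e t) \<sigma>"
  by (auto simp: path_trace_def segment_trace_def)

text \<open>The end omitted by a segment is the start of the rest of the path, so only the final
  point \<open>y\<close> can get lost.\<close>

lemma path_trace_eq_half_traces:
  "is_path G x \<sigma> y \<Longrightarrow> path_trace G x \<sigma> = insert y (half_traces G \<sigma>)"
proof (induction G x \<sigma> y rule: is_path.induct)
  case (1 G x y)
  then show ?case by (simp add: path_trace_def)
next
  case (2 G x e s t \<sigma> y)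
  then have "path_trace G (edge_point G e t) \<sigma> = insert y (half_traces G \<sigma>)" by simp
  moreover have "edge_point G e t \<in> path_trace G (edge_point G e t) \<sigma>"
    by (simp add: path_trace_def)
  ultimately show ?case
    using 2 by (auto simp: path_trace_Cons segment_trace_eq_half_trace)
qed

definition rev_path :: "'e segment list \<Rightarrow> 'e segment list" where
  "rev_path \<sigma> = rev (map (\<lambda>(e, s, t). (e, t, s)) \<sigma>)"

lemma path_length_rev_path [simp]: "path_length (rev_path \<sigma>) = path_length \<sigma>"
  by (induction \<sigma>) (auto simp: rev_path_def)

lemma segment_trace_rev_path:
  "\<Union>(segment_trace G ` set (rev_path \<sigma>)) = \<Union>(segment_trace G ` set \<sigma>)"
  by (induction \<sigma>) (auto simp: rev_path_def segment_trace_def min.commute max.commute)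

section \<open>Unit-speed parametrizations of geodesics\<close>

definition isometry :: "('v, 'e) mgraph \<Rightarrow> (real \<Rightarrow> ('v, 'e) point) \<Rightarrow> real \<Rightarrow> bool" where
  "isometry G \<gamma> l \<longleftrightarrow> \<gamma> ` {0..l} \<subseteq> points G \<and>
     (\<forall>s \<in> {0..l}. \<forall>t \<in> {0..l}. graph_dist G (\<gamma> s) (\<gamma> t) = \<bar>s - t\<bar>)"

text \<open>The local shape of a geodesic: one edge, run through at unit speed in the direction
  \<open>\<kappa>\<close>.\<close>

definition linear_on :: "('v, 'e) mgraph \<Rightarrow> (real \<Rightarrow> ('v, 'e) point) \<Rightarrow> real \<Rightarrow> real \<Rightarrow> bool" where
  "linear_on G \<gamma> u v \<longleftrightarrow> (\<exists>e \<in> edges G. \<exists>a \<kappa>. (\<kappa> = 1 \<or> \<kappa> = -1) \<and>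
     (\<forall>w \<in> {u..v}. a + \<kappa> * w \<in> {0..len G e} \<and> \<gamma> w = edge_point G e (a + \<kappa> * w)))"

text \<open>The interval is half-open so that, for injective \<open>\<gamma>\<close>, the traces
  over adjacent intervals are disjoint and simple paths can be concatenated.\<close>

definition realized :: "('v, 'e) mgraph \<Rightarrow> (real \<Rightarrow> ('v, 'e) point) \<Rightarrow> real \<Rightarrow> real \<Rightarrow> bool" where
  "realized G \<gamma> u v \<longleftrightarrow> (\<exists>\<sigma>. is_path G (\<gamma> u) \<sigma> (\<gamma> v) \<and> path_length \<sigma> = v - u \<and>
     half_traces G \<sigma> = \<gamma> ` {u..<v} \<and> simple_path G \<sigma>)"

lemma isometry_reverse: "isometry G \<gamma> l \<Longrightarrow> isometry G (\<lambda>w. \<gamma> (l - w)) l"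
  by (auto simp: isometry_def)

lemma linear_on_reverse:
  assumes "linear_on G (\<lambda>w. \<gamma> (l - w)) (l - v) (l - u)"
  shows "linear_on G \<gamma> u v"
proof -
  obtain e a \<kappa> where e: "e \<in> edges G" and \<kappa>: "\<kappa> = 1 \<or> \<kappa> = -1"
    and lin: "\<forall>w \<in> {l - v..l - u}. a + \<kappa> * w \<in> {0..len G e} \<and> \<gamma> (l - w) = edge_point G e (a + \<kappa> * w)"
    using assms unfolding linear_on_def by blast
  have "(a + \<kappa> * l) + (- \<kappa>) * w \<in> {0..len G e} \<and> \<gamma> w = edge_point G e ((a + \<kappa> * l) + (- \<kappa>) * w)"
    if "w \<in> {u..v}" for w
    using lin[rule_format, of "l - w"] that by (simp add: algebra_simps)
  moreover have "- \<kappa> = 1 \<or> - \<kappa> = -1" using \<kappa> by auto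
  ultimately show ?thesis using e unfolding linear_on_def by blast
qed

locale connected_metric_graph =
  fixes G :: "('v, 'e) mgraph"
  assumes metric_graph: "metric_graph G" and connected: "connected_graph G"
begin

lemma len_pos: "e \<in> edges G \<Longrightarrow> 0 < len G e"
  using metric_graph by (simp add: metric_graph_def)

lemma edge_point_in_points:
  "e \<in> edges G \<Longrightarrow> t \<in> {0..len G e} \<Longrightarrow> edge_point G e t \<in> points G"
  using metric_graph by (force simp: metric_graph_def edge_point_def points_def)

lemma edge_point_eq_InnerD:
  "edge_point G e s = Inner e' t \<Longrightarrow> e = e' \<and> s = t \<and> s \<noteq> 0 \<and> s \<noteq> len G e"
  by (auto simp: edge_point_def split: if_splits)

lemma is_path_points: "is_path G x \<sigma> y \<Longrightarrow> x \<in> points G \<and> y \<in> points G"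
  by (induction \<sigma> arbitrary: x) (auto simp: edge_point_in_points)

lemma is_path_append:
  "is_path G x (\<sigma> @ \<tau>) z \<longleftrightarrow> (\<exists>y. is_path G x \<sigma> y \<and> is_path G y \<tau> z)"
  by (induction \<sigma> arbitrary: x) (auto dest: is_path_points)

lemma is_path_single:
  "e \<in> edges G \<Longrightarrow> s \<in> {0..len G e} \<Longrightarrow> t \<in> {0..len G e} \<Longrightarrow>
     is_path G (edge_point G e s) [(e, s, t)] (edge_point G e t)"
  by (simp add: edge_point_in_points)

lemma is_path_rev: "is_path G x \<sigma> y \<Longrightarrow> is_path G y (rev_path \<sigma>) x"
proof (induction \<sigma> arbitrary: x)
  case Nil
  then show ?case by (auto simp: rev_path_def)
next
  case (Cons a \<sigma>)
  obtain e s t where a: "a = (e, s, t)" by (cases a)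
  have "is_path G y (rev_path \<sigma>) (edge_point G e t)" using Cons a by simp
  moreover have "is_path G (edge_point G e t) [(e, t, s)] x"
    using Cons.prems a is_path_single[of e t s] by auto
  ultimately show ?case
    using a by (auto simp: rev_path_def is_path_append)
qed

lemma path_trace_rev:
  assumes "is_path G x \<sigma> y"
  shows "path_trace G y (rev_path \<sigma>) = path_trace G x \<sigma>"
proof -
  have "y \<in> path_trace G x \<sigma>" "x \<in> path_trace G y (rev_path \<sigma>)"
    using assms path_trace_eq_half_traces is_path_rev by fastforce+
  then show ?thesis by (auto simp: path_trace_def segment_trace_rev_path)
qed

lemma path_trace_append:
  assumes "is_path G x \<sigma> y" "is_path G y \<tau> z"
  shows "path_trace G x (\<sigma> @ \<tau>) = path_trace G x \<sigma> \<union> path_trace G y \<tau>"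
proof -
  have "y \<in> path_trace G x \<sigma>"
    using assms path_trace_eq_half_traces by fastforce
  then show ?thesis by (auto simp: path_trace_def)
qed

lemma path_trace_points: "is_path G x \<sigma> y \<Longrightarrow> path_trace G x \<sigma> \<subseteq> points G"
proof (induction \<sigma> arbitrary: x)
  case Nil
  then show ?case by (auto simp: path_trace_def)
next
  case (Cons a \<sigma>)
  obtain e s t where a: "a = (e, s, t)" by (cases a)
  have "segment_trace G a \<subseteq> points G"
    using Cons.prems a by (auto simp: segment_trace_def intro!: edge_point_in_points)
  then show ?case using Cons a by (auto simp: path_trace_Cons)
qed

text \<open>Truncation at the first segment that meets \<open>z\<close>. No length bound is kept:
  the purpose is to join points of a cycle inside the cycle.\<close>

lemma subpath_exists:
  "is_path G x \<sigma> y \<Longrightarrow> z \<in> path_trace G x \<sigma> \<Longrightarrow>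
     \<exists>\<tau>. is_path G x \<tau> z \<and> path_trace G x \<tau> \<subseteq> path_trace G x \<sigma>"
proof (induction \<sigma> arbitrary: x)
  case Nil
  then show ?case by (auto simp: path_trace_def intro: exI[of _ "[]"])
next
  case (Cons a \<sigma>)
  obtain e s t where a: "a = (e, s, t)" by (cases a)
  have e: "e \<in> edges G" "s \<in> {0..len G e}" "t \<in> {0..len G e}" "edge_point G e s = x"
    and \<sigma>: "is_path G (edge_point G e t) \<sigma> y"
    using Cons.prems a by auto
  note tr = path_trace_Cons[OF e(4), of t \<sigma>]
  show ?case
  proof (cases "z \<in> segment_trace G a")
    case True
    then obtain w where w: "w \<in> {min s t..max s t}" "z = edge_point G e w"
      by (auto simp: a segment_trace_def)
    have "w \<in> {0..len G e}" using w e by auto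
    then have "is_path G x [(e, s, w)] z" using is_path_single[OF e(1,2)] w e by simp
    moreover have "path_trace G x [(e, s, w)] \<subseteq> segment_trace G a"
      using w e unfolding path_trace_def segment_trace_def a by (auto intro!: imageI)
    ultimately show ?thesis using tr a by blast
  next
    case False
    then have "z \<in> path_trace G (edge_point G e t) \<sigma>" using Cons.prems(2) tr a by auto
    then obtain \<tau> where \<tau>: "is_path G (edge_point G e t) \<tau> z"
      "path_trace G (edge_point G e t) \<tau> \<subseteq> path_trace G (edge_point G e t) \<sigma>"
      using Cons.IH[OF \<sigma>] by blast
    have "is_path G x (a # \<tau>) z" using \<tau> e a by simp
    moreover have "path_trace G x (a # \<tau>) \<subseteq> path_trace G x (a # \<sigma>)"
      using \<tau>(2) a e by (auto simp: path_trace_Cons)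
    ultimately show ?thesis by blast
  qed
qed

text \<open>Connectedness is given for vertices; an interior point is joined to the tail of its
  edge.\<close>

lemma points_connected:
  assumes "x \<in> points G" "y \<in> points G"
  shows "\<exists>\<sigma>. is_path G x \<sigma> y"
proof -
  have *: "\<exists>v \<in> verts G. \<exists>\<sigma>. is_path G (Vertex v) \<sigma> x" if "x \<in> points G" for x
  proof (cases x)
    case (Vertex v)
    then have "v \<in> verts G" using that by (auto simp: points_def)
    then show ?thesis using that Vertex by (intro bexI[of _ v] exI[of _ "[]"]) auto
  next
    case (Inner e t)
    then have et: "e \<in> edges G" "0 < t" "t < len G e" using that by (auto simp: points_def)
    then have "is_path G (Vertex (tail G e)) [(e, 0, t)] x"
      using is_path_single[of e 0 t] Inner by (simp add: edge_point_def)
    moreover have "tail G e \<in> verts G" using et metric_graph by (simp add: metric_graph_def)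
    ultimately show ?thesis by blast
  qed
  obtain u \<sigma> where u: "u \<in> verts G" "is_path G (Vertex u) \<sigma> x" using *[OF assms(1)] by blast
  obtain v \<tau> where v: "v \<in> verts G" "is_path G (Vertex v) \<tau> y" using *[OF assms(2)] by blast
  obtain \<rho> where "is_path G (Vertex u) \<rho> (Vertex v)"
    using connected u v unfolding connected_graph_def by blast
  then have "is_path G x (rev_path \<sigma> @ \<rho> @ \<tau>) y"
    using u v is_path_rev by (auto simp: is_path_append)
  then show ?thesis by blast
qed

section \<open>The path metric\<close>

lemma length_dist_le:
  "is_path G x \<sigma> y \<Longrightarrow> path_trace G x \<sigma> \<subseteq> A \<Longrightarrow> length_dist G A x y \<le> path_length \<sigma>"
  unfolding length_dist_def by (rule cInf_lower) (auto intro!: bdd_belowI[of _ 0] path_length_nonneg)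

lemma graph_dist_le: "is_path G x \<sigma> y \<Longrightarrow> graph_dist G x y \<le> path_length \<sigma>"
  unfolding graph_dist_def by (simp add: length_dist_le path_trace_points)

lemma path_of_graph_dist_less:
  assumes "x \<in> points G" "y \<in> points G" "graph_dist G x y < r"
  obtains \<sigma> where "is_path G x \<sigma> y" "path_length \<sigma> < r"
proof -
  have "{path_length \<sigma> | \<sigma>. is_path G x \<sigma> y \<and> path_trace G x \<sigma> \<subseteq> points G} \<noteq> {}"
    using points_connected[OF assms(1,2)] path_trace_points by blast
  from cInf_lessD[OF this, of r] show ?thesis
    using assms(3) that unfolding graph_dist_def length_dist_def by blast
qed

text \<open>Lower bounds for distances are proved for all paths at once, since no shortest path is
  known to exist.\<close>

lemma le_graph_dist:
  assumes "x \<in> points G" "y \<in> points G" "\<And>\<sigma>. is_path G x \<sigma> y \<Longrightarrow> r \<le> path_length \<sigma>"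
  shows "r \<le> graph_dist G x y"
proof (rule ccontr)
  assume "\<not> r \<le> graph_dist G x y"
  then obtain \<sigma> where "is_path G x \<sigma> y" "path_length \<sigma> < r"
    using path_of_graph_dist_less[OF assms(1,2), of r] by auto
  then show False using assms(3) by fastforce
qed

lemma graph_dist_nonneg: "x \<in> points G \<Longrightarrow> y \<in> points G \<Longrightarrow> 0 \<le> graph_dist G x y"
  by (rule le_graph_dist) (auto simp: path_length_nonneg)

lemma graph_dist_refl: "x \<in> points G \<Longrightarrow> graph_dist G x x = 0"
  using graph_dist_le[of x "[]" x] graph_dist_nonneg[of x x] by simp

lemma graph_dist_sym:
  assumes "x \<in> points G" "y \<in> points G"
  shows "graph_dist G x y = graph_dist G y x"
proof -
  have "graph_dist G x y \<le> graph_dist G y x" if "x \<in> points G" "y \<in> points G" for x y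
  proof (rule le_graph_dist[OF that(2,1)])
    fix \<sigma> assume "is_path G y \<sigma> x"
    then show "graph_dist G x y \<le> path_length \<sigma>"
      using graph_dist_le[OF is_path_rev] by simp
  qed
  then show ?thesis using assms by (simp add: antisym)
qed

lemma graph_dist_triangle:
  assumes "x \<in> points G" "y \<in> points G" "z \<in> points G"
  shows "graph_dist G x z \<le> graph_dist G x y + graph_dist G y z"
proof -
  \<comment> \<open>The infima over the two partial paths are taken one after the other, by moving
    the other terms across.\<close>
  have "graph_dist G x z - graph_dist G x y \<le> graph_dist G y z"
  proof (rule le_graph_dist[OF assms(2,3)])
    fix \<tau> assume \<tau>: "is_path G y \<tau> z"
    have "graph_dist G x z - path_length \<tau> \<le> graph_dist G x y"
    proof (rule le_graph_dist[OF assms(1,2)])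
      fix \<sigma> assume "is_path G x \<sigma> y"
      then have "is_path G x (\<sigma> @ \<tau>) z" using \<tau> by (auto simp: is_path_append)
      from graph_dist_le[OF this] show "graph_dist G x z - path_length \<tau> \<le> path_length \<sigma>" by simp
    qed
    then show "graph_dist G x z - graph_dist G x y \<le> path_length \<tau>" by simp
  qed
  then show ?thesis by simp
qed

subsection \<open>Small balls\<close>

text \<open>The path is too short to reach an end of \<open>e\<close>. Each segment lowers the
  distance to the ends by at most its own length, so the hypothesis persists.\<close>

lemma short_path_from_Inner:
  "is_path G (Inner e t) \<sigma> z \<Longrightarrow> path_length \<sigma> < min t (len G e - t) \<Longrightarrow>
     \<exists>t'. z = Inner e t' \<and> \<bar>t' - t\<bar> \<le> path_length \<sigma>"
proof (induction \<sigma> arbitrary: t)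
  case Nil
  then show ?case by simp
next
  case (Cons a \<sigma>)
  obtain e' s s' where a: "a = (e', s, s')" by (cases a)
  have *: "edge_point G e' s = Inner e t" "is_path G (edge_point G e' s') \<sigma> z" using Cons.prems a by auto
  have es: "e' = e" "s = t" using edge_point_eq_InnerD[OF *(1)] by auto
  have l: "\<bar>s' - t\<bar> + path_length \<sigma> < min t (len G e - t)" using Cons.prems(2) a es by simp
  have "s' \<noteq> 0" "s' \<noteq> len G e" using l path_length_nonneg[of \<sigma>] by auto
  then have "edge_point G e' s' = Inner e s'" using es by (simp add: edge_point_def)
  moreover have "path_length \<sigma> < min s' (len G e - s')" using l by (auto simp: min_def split: if_splits)
  ultimately obtain t' where "z = Inner e t'" "\<bar>t' - s'\<bar> \<le> path_length \<sigma>"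
    using Cons.IH *(2) by metis
  then show ?case using a es by auto
qed

text \<open>Around an interior point the metric is that of an interval: the direct segment bounds
  the distance above, and a path is either too short to leave the edge or longer than the direct
  segment.\<close>

lemma ball_Inner:
  assumes "Inner e t \<in> points G" "z \<in> points G" "graph_dist G (Inner e t) z < min t (len G e - t)"
  shows "\<exists>t'. z = Inner e t' \<and> \<bar>t' - t\<bar> = graph_dist G (Inner e t) z"
proof -
  have et: "e \<in> edges G" "0 < t" "t < len G e" using assms(1) by (auto simp: points_def)
  obtain \<sigma> where \<sigma>: "is_path G (Inner e t) \<sigma> z" "path_length \<sigma> < min t (len G e - t)"
    using path_of_graph_dist_less[OF assms] by blast
  obtain t' where t': "z = Inner e t'" "\<bar>t' - t\<bar> \<le> path_length \<sigma>"
    using short_path_from_Inner[OF \<sigma>] by blast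
  have in': "0 < t'" "t' < len G e" using assms(2) t' by (auto simp: points_def)
  have "is_path G (Inner e t) [(e, t, t')] z"
    using is_path_single[of e t t'] et in' t' by (simp add: edge_point_def)
  from graph_dist_le[OF this] have "graph_dist G (Inner e t) z \<le> \<bar>t' - t\<bar>" by simp
  moreover have "\<bar>t' - t\<bar> \<le> graph_dist G (Inner e t) z"
  proof (rule le_graph_dist[OF assms(1,2)])
    fix \<tau> assume \<tau>: "is_path G (Inner e t) \<tau> z"
    show "\<bar>t' - t\<bar> \<le> path_length \<tau>"
    proof (cases "path_length \<tau> < min t (len G e - t)")
      case True
      then show ?thesis using short_path_from_Inner[OF \<tau>] t' by auto
    next
      case False
      then show ?thesis using t' \<sigma> by linarith
    qed
  qed
  ultimately show ?thesis using t' by auto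
qed

text \<open>The points at depth at most \<open>h\<close> in the star of \<open>v\<close>, measured
  by edge parameters so that no distance is presupposed.\<close>

definition in_star :: "'v \<Rightarrow> real \<Rightarrow> ('v, 'e) point \<Rightarrow> bool" where
  "in_star v h z \<longleftrightarrow> z = Vertex v \<or> (\<exists>e \<in> edges G. \<exists>t. z = Inner e t \<and> 0 < t \<and> t < len G e \<and>
     (tail G e = v \<and> t \<le> h \<or> head G e = v \<and> len G e - t \<le> h))"

text \<open>At depth below \<open>r\<close> a segment cannot reach the far end of an edge of length
  at least \<open>2 * r\<close>, so it only increases the depth by its length.\<close>

lemma in_star_edge_point:
  assumes e: "e \<in> edges G" "s \<in> {0..len G e}" "t \<in> {0..len G e}"
    and star: "in_star v h (edge_point G e s)" "0 \<le> h"
    and r: "\<And>e. e \<in> edges G \<Longrightarrow> tail G e = v \<or> head G e = v \<Longrightarrow> 2 * r \<le> len G e"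
    and "h + \<bar>t - s\<bar> < r"
  shows "in_star v (h + \<bar>t - s\<bar>) (edge_point G e t)"
proof -
  have pos: "0 < len G e" using e len_pos by simp
  have "tail G e = v \<and> s \<le> h \<or> head G e = v \<and> len G e - s \<le> h"
    using star e by (auto simp: in_star_def edge_point_def split: if_splits)
  then consider "tail G e = v" "s \<le> h" | "head G e = v" "len G e - s \<le> h" by blast
  then show ?thesis
  proof cases
    case 1
    then have "2 * r \<le> len G e" using r e by simp
    then have "t \<noteq> len G e" using 1 assms(3,5,7) by auto
    then show ?thesis using 1 e by (auto simp: in_star_def edge_point_def)
  next
    case 2
    then have "2 * r \<le> len G e" using r e by simp
    then have "t \<noteq> 0" using 2 assms(3,5,7) by auto
    then show ?thesis using 2 e by (auto simp: in_star_def edge_point_def)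
  qed
qed

lemma short_path_in_star:
  assumes r: "\<And>e. e \<in> edges G \<Longrightarrow> tail G e = v \<or> head G e = v \<Longrightarrow> 2 * r \<le> len G e"
  shows "is_path G x \<sigma> z \<Longrightarrow> in_star v h x \<Longrightarrow> 0 \<le> h \<Longrightarrow> h + path_length \<sigma> < r \<Longrightarrow>
    in_star v (h + path_length \<sigma>) z"
proof (induction \<sigma> arbitrary: x h)
  case Nil
  then show ?case by simp
next
  case (Cons a \<sigma>)
  obtain e s t where a: "a = (e, s, t)" by (cases a)
  have "in_star v (h + \<bar>t - s\<bar>) (edge_point G e t)"
    using Cons.prems a path_length_nonneg[of \<sigma>] by (intro in_star_edge_point[OF _ _ _ _ _ r]) auto
  then have "in_star v (h + \<bar>t - s\<bar> + path_length \<sigma>) z"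
    using Cons.prems a by (intro Cons.IH) auto
  then show ?case using a by (simp add: add.assoc)
qed

subsection \<open>From simple closed paths to cycles\<close>

lemma start_in_half_trace: "s \<noteq> t \<Longrightarrow> edge_point G e s \<in> half_trace G (e, s, t)"
  by (auto simp: half_trace_def)

text \<open>The second conjunct serves the induction: the first start avoids the half-open traces of
  the rest, hence all later starts.\<close>

lemma simple_path_distinct_starts:
  "simple_path G c \<Longrightarrow>
     distinct (map (\<lambda>(e, s, t). edge_point G e s) c) \<and>
     (\<lambda>(e, s, t). edge_point G e s) ` set c \<subseteq> half_traces G c"
proof (induction c)
  case Nil
  then show ?case by simp
next
  case (Cons a c)
  obtain e s t where a: "a = (e, s, t)" by (cases a)
  have "edge_point G e s \<in> half_trace G a" "edge_point G e s \<notin> half_traces G c"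
    using Cons.prems start_in_half_trace[of s t e] a by (auto simp: simple_path_Cons)
  then show ?case using Cons a by (auto simp: simple_path_Cons)
qed

text \<open>The midpoint of an edge lies in the half-open trace of a full traversal in either
  direction and determines the edge.\<close>

lemma simple_path_distinct_edges:
  "simple_path G c \<Longrightarrow> \<forall>(e, s, t) \<in> set c. e \<in> edges G \<and> {s, t} = {0, len G e} \<Longrightarrow>
     distinct (map fst c) \<and> (\<lambda>e. Inner e (len G e / 2)) ` set (map fst c) \<subseteq> half_traces G c"
proof (induction c)
  case Nil
  then show ?case by simp
next
  case (Cons a c)
  obtain e s t where a: "a = (e, s, t)" by (cases a)
  have IH: "distinct (map fst c)" "(\<lambda>e. Inner e (len G e / 2)) ` set (map fst c) \<subseteq> half_traces G c"
    using Cons a by (auto simp: simple_path_Cons)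
  have e: "e \<in> edges G" "{s, t} = {0, len G e}" using Cons.prems a by auto
  have "edge_point G e (len G e / 2) \<in> half_trace G a"
    unfolding half_trace_def a using e(2) len_pos[OF e(1)]
    by (auto simp: doubleton_eq_iff intro!: imageI)
  then have mid: "Inner e (len G e / 2) \<in> half_trace G a"
    using len_pos[OF e(1)] by (simp add: edge_point_def)
  then have "Inner e (len G e / 2) \<notin> half_traces G c"
    using Cons.prems a by (auto simp: simple_path_Cons)
  then show ?case using IH mid a by auto
qed

lemma vertex_edge_pointD:
  "edge_point G e s = Vertex v \<Longrightarrow> s = 0 \<or> s = len G e"
  by (auto simp: edge_point_def split: if_splits)

text \<open>Every segment ends at \<open>y\<close> or where the next one starts, so at a vertex; a
  nondegenerate segment between vertices is a full edge.\<close>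

lemma is_path_segments_full:
  "is_path G x c y \<Longrightarrow> simple_path G c \<Longrightarrow> y \<in> range Vertex \<Longrightarrow>
     \<forall>(e, s, t) \<in> set c. edge_point G e s \<in> range Vertex \<Longrightarrow>
     (\<forall>(e, s, t) \<in> set c. e \<in> edges G \<and> {s, t} = {0, len G e}) \<and> x \<in> range Vertex"
proof (induction c arbitrary: x)
  case Nil
  then show ?case by auto
next
  case (Cons a c)
  obtain e s t where a: "a = (e, s, t)" by (cases a)
  have IH: "\<forall>(e, s, t) \<in> set c. e \<in> edges G \<and> {s, t} = {0, len G e}" "edge_point G e t \<in> range Vertex"
    using Cons.IH[of "edge_point G e t"] Cons.prems a by (auto simp: simple_path_Cons)
  have "edge_point G e s \<in> range Vertex" "s \<noteq> t" "e \<in> edges G" "edge_point G e s = x"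
    using Cons.prems a by (auto simp: simple_path_Cons)
  moreover from this have "{s, t} = {0, len G e}"
    using IH(2) vertex_edge_pointD by blast
  ultimately show ?case using IH a by auto
qed

text \<open>On a closed path the omitted final point is the start of the first segment, so nothing
  is lost.\<close>

lemma half_traces_closed:
  assumes "is_path G x c x" "c \<noteq> []" "simple_path G c"
  shows "path_trace G x c = half_traces G c" "cycle_trace G c = half_traces G c"
proof -
  obtain e s t c' where c: "c = (e, s, t) # c'" using assms(2) by (metis neq_Nil_conv prod_cases3)
  have x: "x \<in> half_traces G c"
    using assms c start_in_half_trace[of s t e] by (auto simp: simple_path_Cons)
  then show tr: "path_trace G x c = half_traces G c"
    using path_trace_eq_half_traces[OF assms(1)] by auto
  have "x \<in> cycle_trace G c"
    using assms(1) c by (auto simp: cycle_trace_def segment_trace_def)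
  then show "cycle_trace G c = half_traces G c"
    using tr by (auto simp: path_trace_def cycle_trace_def)
qed

lemma half_trace_merge:
  assumes "s0 \<noteq> s" "s \<noteq> t"
    and disj: "half_trace G (e, s0, s) \<inter> half_trace G (e, s, t) = {}"
  shows "s0 < s \<and> s < t \<or> t < s \<and> s < s0"
    and "half_trace G (e, s0, t) = half_trace G (e, s0, s) \<union> half_trace G (e, s, t)"
proof -
  show *: "s0 < s \<and> s < t \<or> t < s \<and> s < s0"
  proof (rule ccontr)
    assume "\<not> ?thesis"
    then consider "s0 < s" "t < s" | "s < s0" "s < t" using assms by linarith
    then show False
    proof cases
      case 1
      \<comment> \<open>If the path turned back at \<open>s\<close>, a point between
        \<open>s\<close> and the nearer of \<open>s0\<close> and \<open>t\<close> would be run over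
        twice.\<close>
      let ?u = "(max s0 t + s) / 2"
      have "edge_point G e ?u \<in> half_trace G (e, s0, s) \<inter> half_trace G (e, s, t)"
        unfolding half_trace_def using 1 by (auto intro!: imageI)
      then show False using disj by simp
    next
      case 2
      let ?u = "(min s0 t + s) / 2"
      have "edge_point G e ?u \<in> half_trace G (e, s0, s) \<inter> half_trace G (e, s, t)"
        unfolding half_trace_def using 2 by (auto intro!: imageI)
      then show False using disj by simp
    qed
  qed
  then have "{min s0 t..max s0 t} - {t} = ({min s0 s..max s0 s} - {s}) \<union> ({min s t..max s t} - {t})"
    by auto
  then show "half_trace G (e, s0, t) = half_trace G (e, s0, s) \<union> half_trace G (e, s, t)"
    by (simp add: half_trace_def image_Un)
qed

lemma simple_path_rotate: "simple_path G (\<sigma> @ \<tau>) \<Longrightarrow> simple_path G (\<tau> @ \<sigma>)"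
  by (auto simp: simple_path_append)

text \<open>
  Consecutive segments meeting at an interior point of an edge run along the same edge in the
  same direction, since their half-open traces are disjoint; merging them shortens the list until
  all segments are full edges.
\<close>

lemma cycle_of_simple_closed:
  "is_path G x c x \<Longrightarrow> c \<noteq> [] \<Longrightarrow> simple_path G c \<Longrightarrow>
     \<exists>c'. is_cycle G c' \<and> path_length c' = path_length c \<and> cycle_trace G c' = path_trace G x c"
proof (induction "length c" arbitrary: c x rule: less_induct)
  case less
  show ?case
  proof (cases "\<forall>(e, s, t) \<in> set c. edge_point G e s \<in> range Vertex")
    case True
    have "x \<in> range Vertex"
    proof -
      obtain e s t c' where "c = (e, s, t) # c'"
        using less.prems(2) by (metis neq_Nil_conv prod_cases3)
      then show ?thesis using less.prems(1) True by auto
    qed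
    then have "\<forall>(e, s, t) \<in> set c. e \<in> edges G \<and> {s, t} = {0, len G e}"
      using is_path_segments_full[OF less.prems(1,3) _ True] by blast
    then have "is_cycle G c"
      unfolding is_cycle_def
      using less.prems simple_path_distinct_starts[OF less.prems(3)]
        simple_path_distinct_edges[OF less.prems(3)] by auto
    then show ?thesis using half_traces_closed[OF less.prems] by auto
  next
    case False
    then obtain e s t where seg: "(e, s, t) \<in> set c" "edge_point G e s \<notin> range Vertex" by auto
    have Inner: "edge_point G e s = Inner e s" "s \<noteq> 0" "s \<noteq> len G e"
      using seg(2) by (auto simp: edge_point_def split: if_splits)
    obtain us vs where c: "c = us @ (e, s, t) # vs" using split_list[OF seg(1)] by blast
    then have us: "is_path G x us (Inner e s)" and vs: "is_path G (Inner e s) ((e, s, t) # vs) x"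
      using less.prems(1) Inner by (auto simp: is_path_append)
    have s: "0 < s" "s < len G e" "e \<in> edges G" "t \<in> {0..len G e}" "s \<noteq> t"
      using vs Inner less.prems(3) c by (auto simp: simple_path_append simple_path_Cons)
    have rest: "is_path G (edge_point G e t) (vs @ us) (Inner e s)"
      using us vs by (auto simp: is_path_append)
    \<comment> \<open>A single nondegenerate segment starting inside an edge does not close
      up.\<close>
    have "vs @ us \<noteq> []"
    proof
      assume "vs @ us = []"
      then have "edge_point G e t = Inner e s" using rest by simp
      then show False using edge_point_eq_InnerD s(5) by metis
    qed
    \<comment> \<open>\<open>a\<close> is the cyclic predecessor of \<open>(e, s, t)\<close>; it
      ends at \<open>Inner e s\<close> and therefore runs along \<open>e\<close> too.\<close>
    then obtain ws a where ws: "vs @ us = ws @ [a]" by (metis rev_exhaust)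
    obtain e' s0 s' where a: "a = (e', s0, s')" by (cases a)
    have ws_path: "is_path G (edge_point G e t) ws (edge_point G e' s0)"
      and a_path: "e' \<in> edges G" "s0 \<in> {0..len G e'}" "edge_point G e' s' = Inner e s"
      using rest ws a by (auto simp: is_path_append)
    have e': "e' = e" "s' = s" using edge_point_eq_InnerD[OF a_path(3)] by auto
    let ?m = "(e, s0, t) # ws"
    have "simple_path G (((e, s, t) # vs) @ us)"
      using less.prems(3) c simple_path_rotate by blast
    then have "simple_path G (((e, s, t) # ws) @ [a])" using ws by simp
    then have "simple_path G ([a] @ ((e, s, t) # ws))" using simple_path_rotate by blast
    then have simp: "s0 \<noteq> s" "simple_path G ws" "half_trace G (e, s0, s) \<inter> half_trace G (e, s, t) = {}"
      "(half_trace G (e, s0, s) \<union> half_trace G (e, s, t)) \<inter> half_traces G ws = {}"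
      using a e' by (auto simp: simple_path_Cons)
    note merge = half_trace_merge[OF simp(1) s(5) simp(3)]
    have s0: "s0 \<in> {0..len G e}" using a_path e' by simp
    have m_simple: "simple_path G ?m"
      using simp merge by (auto simp: simple_path_Cons)
    \<comment> \<open>The base point moves from \<open>x\<close> to the start of \<open>a\<close>.
      This is harmless because the trace of a closed path is its \<open>half_traces\<close>, which
      do not mention the base point.\<close>
    have m_path: "is_path G (edge_point G e s0) ?m (edge_point G e s0)"
      using ws_path s s0 e' by simp
    have len_eq: "path_length us + path_length vs = path_length ws + path_length [a]"
      using arg_cong[OF ws, of path_length] by simp
    have m_len: "path_length ?m = path_length c"
      using len_eq merge(1) c a e' by auto
    have "length us + length vs = length ws + 1" using arg_cong[OF ws, of length] by simp
    then have "length ?m < length c" using c by simp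
    from less.hyps[OF this m_path _ m_simple] obtain c' where
      c': "is_cycle G c'" "path_length c' = path_length ?m" "cycle_trace G c' = half_traces G ?m"
      using half_traces_closed(1)[OF m_path _ m_simple] by auto
    have "half_traces G vs \<union> half_traces G us = half_traces G ws \<union> half_trace G a"
      using arg_cong[OF ws, of "half_traces G"] by simp
    then have "half_traces G ?m = half_traces G c"
      using merge(2) c a e' by auto
    then show ?thesis using c' m_len half_traces_closed(1)[OF less.prems] by auto
  qed
qed

end

section \<open>Balls around vertices in locally finite graphs\<close>

locale locally_finite_metric_graph = connected_metric_graph G for G :: "('v, 'e) mgraph" +
  assumes locally_finite: "locally_finite G"
begin

lemma star_radius_exists:
  assumes "v \<in> verts G"
  obtains r :: real where "0 < r" "\<And>e. e \<in> edges G \<Longrightarrow> tail G e = v \<or> head G e = v \<Longrightarrow> 2 * r \<le> len G e"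
proof -
  \<comment> \<open>The extra element 1 makes the set nonempty when no edge is incident with
    \<open>v\<close>.\<close>
  let ?S = "insert 1 (len G ` {e \<in> edges G. tail G e = v \<or> head G e = v})"
  have fin: "finite ?S" using locally_finite assms by (simp add: locally_finite_def)
  have "0 < Min ?S" using fin len_pos by (subst Min_gr_iff) auto
  moreover have "Min ?S \<le> len G e" if "e \<in> edges G" "tail G e = v \<or> head G e = v" for e
    using fin that by (intro Min_le) auto
  ultimately show ?thesis using that[of "Min ?S / 2"] by auto
qed

text \<open>Within radius \<open>r\<close> the distance to \<open>v\<close> is the edge parameter
  measured from the end \<open>v\<close>. The bound by half the edge length makes this the nearer
  end and keeps the two ends of a loop apart.\<close>

definition star_ball :: "'v \<Rightarrow> real \<Rightarrow> bool" where
  "star_ball v r \<longleftrightarrow>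
     (\<forall>z \<in> points G. graph_dist G (Vertex v) z < r \<longrightarrow> z \<noteq> Vertex v \<longrightarrow>
      (\<exists>e \<in> edges G. 2 * graph_dist G (Vertex v) z < len G e \<and>
       (tail G e = v \<and> z = Inner e (graph_dist G (Vertex v) z) \<or>
        head G e = v \<and> z = Inner e (len G e - graph_dist G (Vertex v) z))))"

text \<open>The direct segment to \<open>v\<close> bounds the distance above; every path shorter
  than \<open>r\<close> stays in the star, which bounds it below.\<close>

lemma star_ball_exists:
  assumes "v \<in> verts G"
  shows "\<exists>r>0. star_ball v r"
proof -
  obtain r where r: "0 < r" "\<And>e. e \<in> edges G \<Longrightarrow> tail G e = v \<or> head G e = v \<Longrightarrow> 2 * r \<le> len G e"
    using star_radius_exists[OF assms] by blast
  have v: "Vertex v \<in> points G" using assms by (simp add: points_def)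
  have "\<exists>e \<in> edges G. 2 * graph_dist G (Vertex v) z < len G e \<and>
       (tail G e = v \<and> z = Inner e (graph_dist G (Vertex v) z) \<or>
        head G e = v \<and> z = Inner e (len G e - graph_dist G (Vertex v) z))"
    if z: "z \<in> points G" "graph_dist G (Vertex v) z < r" "z \<noteq> Vertex v" for z
  proof -
    let ?d = "graph_dist G (Vertex v) z"
    have star: "in_star v (path_length \<sigma>) z" if "is_path G (Vertex v) \<sigma> z" "path_length \<sigma> < r" for \<sigma>
      using short_path_in_star[OF r(2) that(1), where h = 0] that(2) by (simp add: in_star_def)
    obtain \<sigma> where \<sigma>: "is_path G (Vertex v) \<sigma> z" "path_length \<sigma> < r"
      using path_of_graph_dist_less[OF v z(1,2)] by blast
    obtain e t where e: "e \<in> edges G" "z = Inner e t" "0 < t" "t < len G e"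
      and or: "tail G e = v \<and> t \<le> path_length \<sigma> \<or> head G e = v \<and> len G e - t \<le> path_length \<sigma>"
      using star[OF \<sigma>] z(3) unfolding in_star_def by blast
    from or consider "tail G e = v" "t \<le> path_length \<sigma>" | "head G e = v" "len G e - t \<le> path_length \<sigma>"
      by blast
    then show ?thesis
    proof cases
      case 1
      have er: "2 * r \<le> len G e" using r e 1 by simp
      have "is_path G (Vertex v) [(e, 0, t)] z"
        using is_path_single[of e 0 t] e 1 by (simp add: edge_point_def)
      from graph_dist_le[OF this] e have "?d \<le> t" by simp
      moreover have "t \<le> ?d"
      proof (rule le_graph_dist[OF v z(1)])
        fix \<tau> assume \<tau>: "is_path G (Vertex v) \<tau> z"
        \<comment> \<open>For a loop, \<open>in_star\<close> might measure from the other end; then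
          \<open>t\<close> and \<open>len G e - t\<close> would both be below \<open>r\<close>,
          against \<open>2 * r \<le> len G e\<close>.\<close>
        show "t \<le> path_length \<tau>"
          using star[OF \<tau>] e 1 \<sigma>(2) er by (cases "path_length \<tau> < r") (auto simp: in_star_def)
      qed
      ultimately have "?d = t" by simp
      then show ?thesis using 1 e er z(2) by (intro bexI[of _ e]) auto
    next
      case 2
      have er: "2 * r \<le> len G e" using r e 2 by simp
      have "is_path G (Vertex v) [(e, len G e, t)] z"
        using is_path_single[of e "len G e" t] e 2 by (simp add: edge_point_def)
      from graph_dist_le[OF this] e have "?d \<le> len G e - t" by simp
      moreover have "len G e - t \<le> ?d"
      proof (rule le_graph_dist[OF v z(1)])
        fix \<tau> assume \<tau>: "is_path G (Vertex v) \<tau> z"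
        show "len G e - t \<le> path_length \<tau>"
          using star[OF \<tau>] e 2 \<sigma>(2) er by (cases "path_length \<tau> < r") (auto simp: in_star_def)
      qed
      ultimately have "?d = len G e - t" by simp
      then show ?thesis using 2 e er z(2) by (intro bexI[of _ e]) auto
    qed
  qed
  then show ?thesis using r(1) unfolding star_ball_def by blast
qed

text \<open>In small balls the distance is a difference of edge parameters. At a vertex, distance 0
  would give \<open>Inner e 0\<close> or \<open>Inner e (len G e)\<close>, which are not points of
  \<open>G\<close>.\<close>

lemma graph_dist_eq_0D:
  assumes "x \<in> points G" "z \<in> points G" "graph_dist G x z = 0"
  shows "x = z"
proof (cases x)
  case (Inner e t)
  then have "0 < t" "t < len G e" using assms(1) by (auto simp: points_def)
  then show ?thesis using ball_Inner[of e t z] assms Inner by auto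
next
  case (Vertex v)
  then have "v \<in> verts G" using assms(1) by (auto simp: points_def)
  then obtain r where r: "0 < r" "star_ball v r"
    using star_ball_exists by blast
  show ?thesis
  proof (rule ccontr)
    assume "x \<noteq> z"
    then have "\<exists>e \<in> edges G. z = Inner e 0 \<or> z = Inner e (len G e)"
      using r(2)[unfolded star_ball_def, rule_format, OF assms(2)] assms(3) r(1) Vertex by auto
    then show False using assms(2) by (auto simp: points_def)
  qed
qed

subsection \<open>Geodesics are finite concatenations of segments\<close>

text \<open>Near \<open>\<gamma> x\<close> the graph is an interval or a star. The distance to
  \<open>\<gamma> x\<close> leaves few positions for \<open>\<gamma> w\<close>, and the distance to
  \<open>\<gamma> v\<close> selects one of them.\<close>

lemma linear_on_right:
  assumes iso: "isometry G \<gamma> l" and x: "x \<in> {0..l}"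
  shows "\<exists>\<eta>>0. \<forall>v. x < v \<and> v \<le> l \<and> v - x < \<eta> \<longrightarrow> linear_on G \<gamma> x v"
proof -
  have pts: "\<gamma> w \<in> points G" if "w \<in> {0..l}" for w using iso that by (auto simp: isometry_def)
  have dist: "graph_dist G (\<gamma> w) (\<gamma> w') = \<bar>w - w'\<bar>" if "w \<in> {0..l}" "w' \<in> {0..l}" for w w'
    using iso that by (auto simp: isometry_def)
  show ?thesis
  proof (cases "\<gamma> x")
    case (Inner e t)
    then have et: "e \<in> edges G" "0 < t" "t < len G e" using pts[OF x] by (auto simp: points_def)
    define \<rho> where "\<rho> = min t (len G e - t)"
    have "linear_on G \<gamma> x v" if v: "x < v" "v \<le> l" "v - x < \<rho>" for v
    proof -
      have ball: "\<exists>t'. \<gamma> w = Inner e t' \<and> \<bar>t' - t\<bar> = w - x" if "w \<in> {x..v}" for w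
        using ball_Inner[of e t "\<gamma> w"] dist[OF x, of w] pts[of w] pts[OF x] that v x Inner
        by (auto simp: \<rho>_def)
      obtain t1 where t1: "\<gamma> v = Inner e t1" "\<bar>t1 - t\<bar> = v - x" using ball[of v] v by auto
      \<comment> \<open>The direction is read off from the position of
        \<open>\<gamma> v\<close>.\<close>
      define \<kappa> :: real where "\<kappa> = (if t \<le> t1 then 1 else -1)"
      have \<kappa>: "\<kappa> = 1 \<or> \<kappa> = -1" by (simp add: \<kappa>_def)
      have "t - \<kappa> * x + \<kappa> * w \<in> {0..len G e} \<and> \<gamma> w = edge_point G e (t - \<kappa> * x + \<kappa> * w)"
        if w: "w \<in> {x..v}" for w
      proof -
        obtain t' where t': "\<gamma> w = Inner e t'" "\<bar>t' - t\<bar> = w - x" using ball[OF w] by auto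
        have in': "0 < t'" "t' < len G e" using t'(1) pts[of w] w x v by (auto simp: points_def)
        have d: "graph_dist G (Inner e t') (Inner e t1) = v - w"
          using dist[of w v] t' t1 w x v by auto
        \<comment> \<open>Moving from \<open>t\<close> to \<open>t'\<close> costs
          \<open>w - x\<close> of the margin \<open>\<rho>\<close>, and more than
          \<open>v - w\<close> remains; so \<open>\<gamma> v\<close> lies in the interval ball
          around \<open>\<gamma> w\<close>.\<close>
        have "v - w < min t' (len G e - t')"
          using t'(2) v(3) unfolding \<rho>_def min_less_iff_conj by linarith
        then have "\<bar>t1 - t'\<bar> = v - w"
          using ball_Inner[of e t' "Inner e t1"] d t' t1 pts[of w] pts[of v] w x v by auto
        then have "t' = t + \<kappa> * (w - x)"
          using t'(2) t1(2) v(1) by (cases "t \<le> t1"; simp add: \<kappa>_def; linarith)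
        then show ?thesis using t' in' by (simp add: algebra_simps edge_point_def)
      qed
      then show ?thesis unfolding linear_on_def using et \<kappa> by blast
    qed
    moreover have "0 < \<rho>" using et by (simp add: \<rho>_def)
    ultimately show ?thesis by blast
  next
    case (Vertex u)
    then have "u \<in> verts G" using pts[OF x] by (auto simp: points_def)
    then obtain r where r: "0 < r" "star_ball u r" using star_ball_exists by blast
    have star: "\<exists>e \<in> edges G. 2 * (w - x) < len G e \<and>
       (tail G e = u \<and> \<gamma> w = Inner e (w - x) \<or> head G e = u \<and> \<gamma> w = Inner e (len G e - (w - x)))"
      if "x < w" "w \<le> l" "w - x < r" for w
    proof -
      have d: "graph_dist G (Vertex u) (\<gamma> w) = w - x" using dist[OF x, of w] that x Vertex by auto
      moreover have "\<gamma> w \<noteq> Vertex u"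
        using d graph_dist_refl[OF pts[OF x]] Vertex that by auto
      moreover have "\<gamma> w \<in> points G" using pts[of w] that x by simp
      ultimately show ?thesis
        using r(2)[unfolded star_ball_def, rule_format, of "\<gamma> w"] that unfolding d by blast
    qed
    have "linear_on G \<gamma> x v" if v: "x < v" "v \<le> l" "v - x < r" for v
    proof -
      obtain e where e: "e \<in> edges G" "2 * (v - x) < len G e"
        and or: "tail G e = u \<and> \<gamma> v = Inner e (v - x) \<or>
          head G e = u \<and> \<gamma> v = Inner e (len G e - (v - x))"
        using star[OF v] by blast
      \<comment> \<open>The distance of \<open>\<gamma> v\<close> to the ends of \<open>e\<close> is
        \<open>v - x\<close>, more than \<open>v - w\<close>, so \<open>\<gamma> w\<close> lies on
        the same edge; \<open>star\<close> then gives its distance \<open>w - x\<close> from an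
        end.\<close>
      have near: "\<exists>t'. \<gamma> w = Inner e t' \<and> \<bar>t' - t\<bar> = v - w \<and> (t' = w - x \<or> t' = len G e - (w - x))"
        if w: "x < w" "w \<le> v" and t: "\<gamma> v = Inner e t" "min t (len G e - t) = v - x" for w t
      proof -
        have "w \<in> {0..l}" "v \<in> {0..l}" using w x v by auto
        then obtain t' where t': "\<gamma> w = Inner e t'" "\<bar>t' - t\<bar> = v - w"
          using ball_Inner[of e t "\<gamma> w"] dist[of v w] pts[of w] pts[of v] w t by auto
        obtain e' where "\<gamma> w = Inner e' (w - x) \<or> \<gamma> w = Inner e' (len G e' - (w - x))"
          using star[of w] w v by auto
        then show ?thesis using t' by auto
      qed
      from or show ?thesis
      proof
        assume t: "tail G e = u \<and> \<gamma> v = Inner e (v - x)"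
        have "- x + 1 * w \<in> {0..len G e} \<and> \<gamma> w = edge_point G e (- x + 1 * w)"
          if w: "w \<in> {x..v}" for w
        proof (cases "w = x")
          case True
          then show ?thesis using t Vertex len_pos[OF e(1)] by (simp add: edge_point_def)
        next
          case False
          then have "x < w" using w by simp
          \<comment> \<open>The position measured from the other end is too far from
            \<open>\<gamma> v\<close>, because \<open>2 * (v - x) < len G e\<close>.\<close>
          then have "\<gamma> w = Inner e (w - x)"
            using near[of w "v - x"] w e t v by auto
          then show ?thesis using w e \<open>x < w\<close> by (auto simp: edge_point_def)
        qed
        then show ?thesis unfolding linear_on_def using e(1) by blast
      next
        assume t: "head G e = u \<and> \<gamma> v = Inner e (len G e - (v - x))"
        have "(len G e + x) + (-1) * w \<in> {0..len G e} \<and> \<gamma> w = edge_point G e ((len G e + x) + (-1) * w)"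
          if w: "w \<in> {x..v}" for w
        proof (cases "w = x")
          case True
          then show ?thesis using t Vertex len_pos[OF e(1)] by (simp add: edge_point_def)
        next
          case False
          then have "x < w" using w by simp
          then have "\<gamma> w = Inner e (len G e - (w - x))"
            using near[of w "len G e - (v - x)"] w e t v by auto
          then show ?thesis using w e \<open>x < w\<close> by (auto simp: edge_point_def algebra_simps)
        qed
        then show ?thesis unfolding linear_on_def using e(1) by blast
      qed
    qed
    then show ?thesis using r(1) by blast
  qed
qed

lemma linear_on_left:
  assumes iso: "isometry G \<gamma> l" and x: "x \<in> {0..l}"
  shows "\<exists>\<eta>>0. \<forall>u. u < x \<and> 0 \<le> u \<and> x - u < \<eta> \<longrightarrow> linear_on G \<gamma> u x"
proof -
  obtain \<eta> where \<eta>: "\<eta> > 0"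
    "\<forall>v. l - x < v \<and> v \<le> l \<and> v - (l - x) < \<eta> \<longrightarrow> linear_on G (\<lambda>w. \<gamma> (l - w)) (l - x) v"
    using linear_on_right[OF isometry_reverse[OF iso], of "l - x"] x by auto
  have "linear_on G \<gamma> u x" if "u < x" "0 \<le> u" "x - u < \<eta>" for u
    using \<eta>(2)[rule_format, of "l - u"] that by (intro linear_on_reverse[of G \<gamma> l x u]) auto
  then show ?thesis using \<eta>(1) by blast
qed

lemma realized_refl: "\<gamma> u \<in> points G \<Longrightarrow> realized G \<gamma> u u"
  unfolding realized_def by (intro exI[of _ "[]"]) auto

lemma realized_of_linear_on:
  assumes "linear_on G \<gamma> u v" "u < v"
  shows "realized G \<gamma> u v"
proof -
  obtain e a \<kappa> where e: "e \<in> edges G" and \<kappa>: "\<kappa> = 1 \<or> \<kappa> = -1"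
    and lin: "\<forall>w \<in> {u..v}. a + \<kappa> * w \<in> {0..len G e} \<and> \<gamma> w = edge_point G e (a + \<kappa> * w)"
    using assms(1) unfolding linear_on_def by blast
  let ?s = "a + \<kappa> * u" and ?t = "a + \<kappa> * v"
  have "{min ?s ?t..max ?s ?t} - {?t} = (\<lambda>w. a + \<kappa> * w) ` {u..<v}"
  proof (intro set_eqI iffI)
    fix y assume "y \<in> {min ?s ?t..max ?s ?t} - {?t}"
    then show "y \<in> (\<lambda>w. a + \<kappa> * w) ` {u..<v}"
      using \<kappa> assms(2) by (intro image_eqI[of _ _ "\<kappa> * (y - a)"]) (auto simp: algebra_simps)
  next
    fix y assume "y \<in> (\<lambda>w. a + \<kappa> * w) ` {u..<v}"
    then show "y \<in> {min ?s ?t..max ?s ?t} - {?t}" using \<kappa> assms(2) by auto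
  qed
  then have "half_trace G (e, ?s, ?t) = \<gamma> ` {u..<v}"
    using lin by (simp add: half_trace_def image_image)
  moreover have "is_path G (\<gamma> u) [(e, ?s, ?t)] (\<gamma> v)"
    using is_path_single[OF e, of ?s ?t] lin assms(2) by auto
  moreover have "\<bar>?t - ?s\<bar> = v - u" "?s \<noteq> ?t" using \<kappa> assms(2) by auto
  ultimately show ?thesis
    unfolding realized_def by (intro exI[of _ "[(e, ?s, ?t)]"]) (auto simp: simple_path_Cons)
qed

lemma realized_trans:
  assumes "realized G \<gamma> u v" "realized G \<gamma> v w" "u \<le> v" "v \<le> w" "inj_on \<gamma> {u..w}"
  shows "realized G \<gamma> u w"
proof -
  obtain \<sigma> \<tau> where \<sigma>: "is_path G (\<gamma> u) \<sigma> (\<gamma> v)" "path_length \<sigma> = v - u"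
      "half_traces G \<sigma> = \<gamma> ` {u..<v}" "simple_path G \<sigma>"
    and \<tau>: "is_path G (\<gamma> v) \<tau> (\<gamma> w)" "path_length \<tau> = w - v"
      "half_traces G \<tau> = \<gamma> ` {v..<w}" "simple_path G \<tau>"
    using assms(1,2) unfolding realized_def by blast
  have "{u..<w} = {u..<v} \<union> {v..<w}" using assms by auto
  then have "half_traces G (\<sigma> @ \<tau>) = \<gamma> ` {u..<w}" using \<sigma> \<tau> by auto
  moreover have "\<gamma> ` {u..<v} \<inter> \<gamma> ` {v..<w} = \<gamma> ` ({u..<v} \<inter> {v..<w})"
    using assms by (intro inj_on_image_Int[OF assms(5), symmetric]) auto
  ultimately show ?thesis unfolding realized_def
    using \<sigma> \<tau> by (intro exI[of _ "\<sigma> @ \<tau>"]) (auto simp: is_path_append simple_path_append)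
qed

lemma isometry_inj_on: "isometry G \<gamma> l \<Longrightarrow> inj_on \<gamma> {0..l}"
proof (rule inj_onI)
  fix s t assume iso: "isometry G \<gamma> l" and st: "s \<in> {0..l}" "t \<in> {0..l}" "\<gamma> s = \<gamma> t"
  have "graph_dist G (\<gamma> s) (\<gamma> t) = \<bar>s - t\<bar>" "\<gamma> s \<in> points G"
    using iso st(1,2) by (auto simp: isometry_def)
  then show "s = t" using graph_dist_refl[of "\<gamma> s"] st(3) by simp
qed

text \<open>Each parameter has a one-segment neighborhood on either side; compactness of the
  interval, in the form of Bolzano induction, leaves finitely many segments to concatenate.\<close>

lemma isometry_realized:
  assumes iso: "isometry G \<gamma> l" and uv: "0 \<le> u" "u \<le> v" "v \<le> l"
  shows "realized G \<gamma> u v"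
proof -
  \<comment> \<open>The bounds belong to the induction predicate because the local case also ranges
    over intervals that leave \<open>{0..l}\<close>.\<close>
  have "0 \<le> u \<and> v \<le> l \<longrightarrow> realized G \<gamma> u v"
    using uv(2)
  proof (induction u v rule: Bolzano)
    case (trans a b c)
    then show ?case
      using inj_on_subset[OF isometry_inj_on[OF iso], of "{a..c}"] realized_trans[of \<gamma> a b c] by auto
  next
    case (local x)
    then have x: "x \<in> {0..l}" using uv by auto
    obtain \<eta>1 where \<eta>1: "\<eta>1 > 0" "\<forall>u. u < x \<and> 0 \<le> u \<and> x - u < \<eta>1 \<longrightarrow> linear_on G \<gamma> u x"
      using linear_on_left[OF iso x] by blast
    obtain \<eta>2 where \<eta>2: "\<eta>2 > 0" "\<forall>v. x < v \<and> v \<le> l \<and> v - x < \<eta>2 \<longrightarrow> linear_on G \<gamma> x v"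
      using linear_on_right[OF iso x] by blast
    have pt: "\<gamma> x \<in> points G" using iso x by (auto simp: isometry_def)
    \<comment> \<open>The interval is split at \<open>x\<close>, since at a vertex the geodesic may
      change edges.\<close>
    have "realized G \<gamma> a b" if ab: "a \<le> x" "x \<le> b" "b - a < min \<eta>1 \<eta>2" "0 \<le> a" "b \<le> l" for a b
    proof (rule realized_trans)
      show "realized G \<gamma> a x"
        using \<eta>1(2) ab realized_refl[of \<gamma> x, OF pt] realized_of_linear_on[of \<gamma> a x] by (cases "a = x") auto
      show "realized G \<gamma> x b"
        using \<eta>2(2) ab realized_refl[of \<gamma> x, OF pt] realized_of_linear_on[of \<gamma> x b] by (cases "x = b") auto
      show "inj_on \<gamma> {a..b}"
        using inj_on_subset[OF isometry_inj_on[OF iso], of "{a..b}"] ab by auto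
    qed (use ab in auto)
    then show ?case using \<eta>1(1) \<eta>2(1) by (intro exI[of _ "min \<eta>1 \<eta>2"]) auto
  qed
  then show ?thesis using uv by simp
qed

lemma isometry_path:
  assumes iso: "isometry G \<gamma> l" and pq: "p \<in> {0..l}" "q \<in> {0..l}"
  obtains \<sigma> where "is_path G (\<gamma> p) \<sigma> (\<gamma> q)" "path_length \<sigma> = \<bar>p - q\<bar>"
    "half_traces G \<sigma> = \<gamma> ` ({min p q..max p q} - {q})" "simple_path G \<sigma>"
    "path_trace G (\<gamma> p) \<sigma> = \<gamma> ` {min p q..max p q}"
proof -
  have "\<exists>\<sigma>. is_path G (\<gamma> p) \<sigma> (\<gamma> q) \<and> path_length \<sigma> = \<bar>p - q\<bar> \<and>
    half_traces G \<sigma> = \<gamma> ` ({min p q..max p q} - {q}) \<and> simple_path G \<sigma>"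
  proof (cases "p \<le> q")
    case True
    then have "{min p q..max p q} - {q} = {p..<q}" by auto
    then show ?thesis
      using isometry_realized[OF iso, of p q] True pq unfolding realized_def by auto
  next
    case False
    let ?\<gamma> = "\<lambda>w. \<gamma> (l - w)"
    have "{min p q..max p q} - {q} = (\<lambda>w. l - w) ` {l - p..<l - q}"
      using False by (auto intro: image_eqI[of _ _ "l - _"])
    then have "?\<gamma> ` {l - p..<l - q} = \<gamma> ` ({min p q..max p q} - {q})"
      by (simp only: image_image)
    then show ?thesis
      using isometry_realized[OF isometry_reverse[OF iso], of "l - p" "l - q"] False pq
      unfolding realized_def by auto
  qed
  then obtain \<sigma> where \<sigma>: "is_path G (\<gamma> p) \<sigma> (\<gamma> q)" "path_length \<sigma> = \<bar>p - q\<bar>"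
    "half_traces G \<sigma> = \<gamma> ` ({min p q..max p q} - {q})" "simple_path G \<sigma>" by blast
  have "path_trace G (\<gamma> p) \<sigma> = insert (\<gamma> q) (\<gamma> ` ({min p q..max p q} - {q}))"
    using path_trace_eq_half_traces[OF \<sigma>(1)] \<sigma>(3) by simp
  also have "\<dots> = \<gamma> ` {min p q..max p q}" by auto
  finally show ?thesis using that \<sigma> by blast
qed

subsection \<open>Cycles inside geodesic triangles\<close>

text \<open>The distance from \<open>\<gamma> x\<close> to the other geodesic is a minimum of a
  continuous function on a compact interval, hence positive off it, and \<open>\<gamma>\<close>
  moves at unit speed. This yields first and last meeting points.\<close>

lemma closed_preimage_of_isometry_image:
  assumes \<gamma>: "isometry G \<gamma> l" and \<beta>: "isometry G \<beta> l'" and "0 \<le> l'"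
  shows "closed {w \<in> {0..l}. \<gamma> w \<in> \<beta> ` {0..l'}}" (is "closed ?K")
proof -
  have \<gamma>pts: "\<gamma> w \<in> points G" if "w \<in> {0..l}" for w using \<gamma> that by (auto simp: isometry_def)
  have \<beta>pts: "\<beta> w \<in> points G" if "w \<in> {0..l'}" for w using \<beta> that by (auto simp: isometry_def)
  have "\<exists>e>0. \<forall>y. dist y x < e \<longrightarrow> y \<in> - ?K" if x: "x \<in> - ?K" for x
  proof (cases "x \<in> {0..l}")
    case False
    have "open (- {0..l})" by (intro open_Compl closed_atLeastAtMost)
    then obtain e where "e > 0" "\<forall>y. dist y x < e \<longrightarrow> y \<in> - {0..l}"
      using False unfolding open_dist by blast
    then show ?thesis by blast
  next
    case True
    let ?f = "\<lambda>v. graph_dist G (\<gamma> x) (\<beta> v)"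
    have "?f v \<le> ?f v' + \<bar>v - v'\<bar>" if "v \<in> {0..l'}" "v' \<in> {0..l'}" for v v'
      using graph_dist_triangle[OF \<gamma>pts[OF True] \<beta>pts[OF that(2)] \<beta>pts[OF that(1)]] \<beta> that
      by (auto simp: isometry_def)
    then have lip: "\<bar>?f v' - ?f v\<bar> \<le> \<bar>v' - v\<bar>" if "v \<in> {0..l'}" "v' \<in> {0..l'}" for v v'
      using that by (smt (verit))
    have "continuous_on {0..l'} ?f"
      unfolding continuous_on_def
    proof (intro ballI tendstoI)
      fix v e :: real assume "v \<in> {0..l'}" "0 < e"
      then show "\<forall>\<^sub>F v' in at v within {0..l'}. dist (?f v') (?f v) < e"
        unfolding eventually_at dist_real_def
        by (intro exI[of _ e]) (auto intro!: le_less_trans[OF lip])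
    qed
    then obtain v where v: "v \<in> {0..l'}" "\<forall>v' \<in> {0..l'}. ?f v \<le> ?f v'"
      using continuous_attains_inf[of "{0..l'}" ?f] \<open>0 \<le> l'\<close> by auto
    have "?f v \<noteq> 0" using graph_dist_eq_0D[OF \<gamma>pts[OF True] \<beta>pts[OF v(1)]] x v True by auto
    then have pos: "0 < ?f v" using graph_dist_nonneg[OF \<gamma>pts[OF True] \<beta>pts[OF v(1)]] by simp
    have "y \<in> - ?K" if "dist y x < ?f v" for y
    proof
      assume "y \<in> ?K"
      then obtain v' where y: "y \<in> {0..l}" "v' \<in> {0..l'}" "\<gamma> y = \<beta> v'" by auto
      have "?f v' = \<bar>x - y\<bar>" using \<gamma> True y by (metis isometry_def)
      then show False using bspec[OF v(2) y(2)] that by (simp add: dist_real_def)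
    qed
    then show ?thesis using pos by blast
  qed
  then show ?thesis unfolding closed_def open_dist by blast
qed

text \<open>\<open>\<beta>\<close> and \<open>\<eta>\<close> are the sides through the two ends of
  the arc, both directed to the opposite vertex. They may coincide; then \<open>tc = ta\<close> and
  the arc on \<open>\<beta>\<close> is trivial.\<close>

lemma simple_triangle_cycle:
  assumes \<alpha>: "isometry G \<alpha> l" and \<beta>: "isometry G \<beta> lb" and \<eta>: "isometry G \<eta> le"
    and s: "0 \<le> sa" "sa < sb" "sb \<le> l"
    and "0 \<le> le" and z: "\<beta> lb = \<eta> le"
    and a: "\<alpha> sa \<in> \<beta> ` {0..lb}" and b: "\<alpha> sb \<in> \<eta> ` {0..le}"
    and avoid: "\<And>w. sa < w \<Longrightarrow> w < sb \<Longrightarrow> \<alpha> w \<notin> \<beta> ` {0..lb} \<union> \<eta> ` {0..le}"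
  obtains c N where "is_cycle G c" "cycle_trace G c = \<alpha> ` {sa..sb} \<union> N"
    "N \<subseteq> \<beta> ` {0..lb} \<union> \<eta> ` {0..le}" "2 * (sb - sa) \<le> path_length c"
proof -
  obtain ta where ta: "ta \<in> {0..lb}" "\<alpha> sa = \<beta> ta" using a by auto
  obtain ub where ub: "ub \<in> {0..le}" "\<alpha> sb = \<eta> ub" using b by auto
  \<comment> \<open>The parameters where \<open>\<beta>\<close>, followed from
    \<open>\<alpha> sa\<close>, meets \<open>\<eta>\<close>; the common end \<open>lb\<close> is one
    of them, and \<open>tc\<close> is the first.\<close>
  let ?K = "{ta..lb} \<inter> {w \<in> {0..lb}. \<beta> w \<in> \<eta> ` {0..le}}"
  have "compact ?K"
    using closed_preimage_of_isometry_image[OF \<beta> \<eta> \<open>0 \<le> le\<close>] by (intro compact_Int_closed) auto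
  moreover have "lb \<in> ?K" using ta z \<open>0 \<le> le\<close> by auto
  ultimately obtain tc where tc: "tc \<in> ?K" "\<forall>w \<in> ?K. tc \<le> w"
    using compact_attains_inf[of ?K] by blast
  obtain uc where uc: "uc \<in> {0..le}" "\<beta> tc = \<eta> uc" using tc by auto
  have tatc: "ta \<le> tc" "tc \<in> {0..lb}" using tc by auto
  have first: "\<beta> w \<notin> \<eta> ` {0..le}" if "ta \<le> w" "w < tc" for w
  proof
    assume "\<beta> w \<in> \<eta> ` {0..le}"
    then have "w \<in> ?K" using that tc(1) ta(1) by auto
    then show False using bspec[OF tc(2), of w] that(2) by simp
  qed
  have sasb: "sa \<in> {0..l}" "sb \<in> {0..l}" using s by auto
  have inj: "\<beta> w = \<beta> w' \<Longrightarrow> w \<in> {0..lb} \<Longrightarrow> w' \<in> {0..lb} \<Longrightarrow> w = w'"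
    "\<eta> w = \<eta> w' \<Longrightarrow> w \<in> {0..le} \<Longrightarrow> w' \<in> {0..le} \<Longrightarrow> w = w'" for w w'
    using isometry_inj_on[OF \<beta>] isometry_inj_on[OF \<eta>] by (auto simp: inj_on_def)
  obtain \<pi> where \<pi>: "is_path G (\<alpha> sa) \<pi> (\<alpha> sb)" "path_length \<pi> = \<bar>sa - sb\<bar>"
    "half_traces G \<pi> = \<alpha> ` ({min sa sb..max sa sb} - {sb})" "simple_path G \<pi>"
    "path_trace G (\<alpha> sa) \<pi> = \<alpha> ` {min sa sb..max sa sb}"
    by (rule isometry_path[OF \<alpha> sasb])
  obtain \<rho> where \<rho>: "is_path G (\<eta> ub) \<rho> (\<eta> uc)" "path_length \<rho> = \<bar>ub - uc\<bar>"
    "half_traces G \<rho> = \<eta> ` ({min ub uc..max ub uc} - {uc})" "simple_path G \<rho>"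
    "path_trace G (\<eta> ub) \<rho> = \<eta> ` {min ub uc..max ub uc}"
    by (rule isometry_path[OF \<eta> ub(1) uc(1)])
  obtain \<tau> where \<tau>: "is_path G (\<beta> tc) \<tau> (\<beta> ta)" "path_length \<tau> = \<bar>tc - ta\<bar>"
    "half_traces G \<tau> = \<beta> ` ({min tc ta..max tc ta} - {ta})" "simple_path G \<tau>"
    "path_trace G (\<beta> tc) \<tau> = \<beta> ` {min tc ta..max tc ta}"
    by (rule isometry_path[OF \<beta> tatc(2) ta(1)])
  have R: "{min ub uc..max ub uc} \<subseteq> {0..le}" using ub uc by auto
  have Q: "{min tc ta..max tc ta} = {ta..tc}" using tatc by auto
  have P: "{min sa sb..max sa sb} = {sa..sb}" using s by auto
  \<comment> \<open>Two of the arcs can meet only at a corner, and each corner is omitted by the arc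
    that ends there: \<open>sb\<close> by \<open>\<pi>\<close>, \<open>uc\<close> by
    \<open>\<rho>\<close>, \<open>ta\<close> by \<open>\<tau>\<close>. If \<open>\<pi>\<close> meets
    \<open>\<rho>\<close> at \<open>sa\<close>, then \<open>ta = tc\<close> and the point is again
    \<open>\<eta> uc\<close>.\<close>
  have "half_traces G \<pi> \<inter> half_traces G \<rho> = {}"
  proof (rule ccontr)
    assume "half_traces G \<pi> \<inter> half_traces G \<rho> \<noteq> {}"
    then obtain y where "y \<in> \<alpha> ` ({sa..sb} - {sb})" "y \<in> \<eta> ` ({min ub uc..max ub uc} - {uc})"
      unfolding \<pi>(3) \<rho>(3) P by blast
    then obtain w r where "\<alpha> w = \<eta> r" "w \<in> {sa..sb} - {sb}" "r \<in> {min ub uc..max ub uc} - {uc}"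
      by (elim imageE) simp
    then have wr: "\<alpha> w = \<eta> r" "sa \<le> w" "w \<le> sb" "w \<noteq> sb" "r \<in> {0..le}" "r \<noteq> uc"
      using R by auto
    have "\<alpha> w \<in> \<eta> ` {0..le}" using wr by auto
    then have "w = sa" using avoid[of w] wr(2-4) by fastforce
    then have "\<beta> ta \<in> \<eta> ` {0..le}" using wr ta by auto
    then have "ta = tc" using first[of ta] tatc(1) by fastforce
    then show False using inj(2)[of r uc] wr ta uc \<open>w = sa\<close> by simp
  qed
  moreover have "half_traces G \<pi> \<inter> half_traces G \<tau> = {}"
  proof (rule ccontr)
    assume "half_traces G \<pi> \<inter> half_traces G \<tau> \<noteq> {}"
    then obtain y where "y \<in> \<alpha> ` ({sa..sb} - {sb})" "y \<in> \<beta> ` ({ta..tc} - {ta})"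
      unfolding \<pi>(3) \<tau>(3) P Q by blast
    then obtain w q where "\<alpha> w = \<beta> q" "w \<in> {sa..sb} - {sb}" "q \<in> {ta..tc} - {ta}"
      by (elim imageE) simp
    then have wq: "\<alpha> w = \<beta> q" "sa \<le> w" "w \<le> sb" "w \<noteq> sb" "ta < q" "q \<le> tc"
      by auto
    have "q \<in> {0..lb}" using wq ta tatc by auto
    then have "\<alpha> w \<in> \<beta> ` {0..lb}" using wq by auto
    then have "w = sa" using avoid[of w] wq(2-4) by fastforce
    then show False using inj(1)[of q ta] wq ta \<open>q \<in> {0..lb}\<close> by simp
  qed
  moreover have "half_traces G \<rho> \<inter> half_traces G \<tau> = {}"
  proof (rule ccontr)
    assume "half_traces G \<rho> \<inter> half_traces G \<tau> \<noteq> {}"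
    then obtain y where "y \<in> \<eta> ` ({min ub uc..max ub uc} - {uc})" "y \<in> \<beta> ` ({ta..tc} - {ta})"
      unfolding \<rho>(3) \<tau>(3) Q by blast
    then obtain r q where "\<eta> r = \<beta> q" "r \<in> {min ub uc..max ub uc} - {uc}" "q \<in> {ta..tc} - {ta}"
      by (elim imageE) simp
    then have rq: "\<eta> r = \<beta> q" "r \<in> {min ub uc..max ub uc}" "r \<noteq> uc" "ta < q" "q \<le> tc"
      by auto
    have r: "r \<in> {0..le}" using rq R by blast
    then have "\<beta> q \<in> \<eta> ` {0..le}" using rq(1) by (metis imageI)
    then have "q = tc" using first[of q] rq(4,5) by fastforce
    then show False using inj(2)[of r uc] rq r uc by simp
  qed
  ultimately have simple: "simple_path G (\<pi> @ \<rho> @ \<tau>)"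
    using \<pi> \<rho> \<tau> by (auto simp: simple_path_append)
  have closed: "is_path G (\<alpha> sa) (\<pi> @ \<rho> @ \<tau>) (\<alpha> sa)"
    and ret: "is_path G (\<alpha> sb) (\<rho> @ \<tau>) (\<alpha> sa)"
    using \<pi> \<rho> \<tau> ta ub uc by (auto simp: is_path_append)
  have "\<pi> \<noteq> []" using \<pi>(2) s by auto
  then obtain c where c: "is_cycle G c" "path_length c = path_length (\<pi> @ \<rho> @ \<tau>)"
    "cycle_trace G c = path_trace G (\<alpha> sa) (\<pi> @ \<rho> @ \<tau>)"
    using cycle_of_simple_closed[OF closed _ simple] by auto
  define N where "N = \<eta> ` {min ub uc..max ub uc} \<union> \<beta> ` {ta..tc}"
  have "path_trace G (\<alpha> sa) (\<pi> @ \<rho> @ \<tau>) = \<alpha> ` {sa..sb} \<union> N"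
    using path_trace_append[OF \<pi>(1) ret] path_trace_append[of "\<eta> ub" \<rho> "\<eta> uc" \<tau> "\<beta> ta"]
      \<pi>(5) \<rho>(1,5) \<tau>(1,5) P Q ub(2) uc(2) ta(2) by (simp add: N_def)
  moreover have "N \<subseteq> \<beta> ` {0..lb} \<union> \<eta> ` {0..le}"
    using R tatc ta unfolding N_def by fastforce
  \<comment> \<open>The rest of the cycle joins the ends of the geodesic arc, so it is at least as
    long as the arc.\<close>
  moreover have "graph_dist G (\<alpha> sb) (\<alpha> sa) = sb - sa"
    using \<alpha> sasb s by (auto simp: isometry_def)
  then have "2 * (sb - sa) \<le> path_length c"
    using graph_dist_le[OF ret] c(2) \<pi>(2) s by simp
  ultimately show ?thesis using that c by simp
qed

section \<open>Shortcuts and thinness of triangles\<close>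

lemma graph_dist_le_cycle_dist:
  assumes "is_cycle G c" "y \<in> cycle_trace G c" "z \<in> cycle_trace G c"
  shows "graph_dist G y z \<le> cycle_dist G c y z"
proof -
  obtain x where x: "is_path G x c x" "c \<noteq> []" using assms(1) by (auto simp: is_cycle_def)
  then have "x \<in> cycle_trace G c"
    by (cases c) (auto simp: cycle_trace_def segment_trace_def)
  then have tr: "path_trace G x c = cycle_trace G c" by (auto simp: path_trace_def cycle_trace_def)
  obtain \<sigma> \<tau> where \<sigma>: "is_path G x \<sigma> y" "path_trace G x \<sigma> \<subseteq> cycle_trace G c"
    and \<tau>: "is_path G x \<tau> z" "path_trace G x \<tau> \<subseteq> cycle_trace G c"
    using subpath_exists[OF x(1)] assms(2,3) tr by metis
  have "is_path G y (rev_path \<sigma> @ \<tau>) z" using is_path_rev[OF \<sigma>(1)] \<tau> by (auto simp: is_path_append)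
  moreover have "path_trace G y (rev_path \<sigma> @ \<tau>) \<subseteq> cycle_trace G c"
    using path_trace_append[OF is_path_rev[OF \<sigma>(1)] \<tau>(1)] path_trace_rev[OF \<sigma>(1)] \<sigma> \<tau> by simp
  \<comment> \<open>Nonemptiness matters: only then is \<open>cycle_dist\<close> a genuine infimum
    over paths, here over fewer paths than \<open>graph_dist\<close>.\<close>
  ultimately have "{path_length \<sigma> | \<sigma>. is_path G y \<sigma> z \<and> path_trace G y \<sigma> \<subseteq> cycle_trace G c} \<noteq> {}"
    by blast
  then show ?thesis
    unfolding cycle_dist_def length_dist_def by (rule cInf_greatest) (auto intro: graph_dist_le)
qed

text \<open>\<open>N\<close> stands for the union of the other two sides and \<open>N'\<close> for
  the part of the cycle on them.\<close>

lemma near_triangle_sides: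
  assumes chordal: "densely_path_chordal G \<epsilon> k m"
    and \<alpha>: "isometry G \<alpha> l" and s: "0 \<le> sa" "sa < x" "x < sb" "sb \<le> l" and N: "\<alpha> sa \<in> N" "\<alpha> sb \<in> N"
    and c: "is_cycle G c" "cycle_trace G c = \<alpha> ` {sa..sb} \<union> N'" "N' \<subseteq> N" "N \<subseteq> points G"
      "2 * (sb - sa) \<le> path_length c"
    and pos: "0 < \<epsilon>" "0 \<le> m"
  shows "\<exists>y \<in> N. graph_dist G (\<alpha> x) y \<le> max (k / 4) (\<epsilon> + m)"
proof (cases "k \<le> path_length c")
  case False
  have d: "graph_dist G (\<alpha> x) (\<alpha> sa) = x - sa" "graph_dist G (\<alpha> x) (\<alpha> sb) = sb - x"
    using \<alpha> s by (auto simp: isometry_def)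
  \<comment> \<open>Otherwise \<open>sb - sa > k / 2\<close>, and the cycle would be longer than
    \<open>k\<close>.\<close>
  have "x - sa \<le> k / 4 \<or> sb - x \<le> k / 4" using False c(5) by argo
  then show ?thesis using d N by (metis max.coboundedI1)
next
  case True
  have dist: "graph_dist G (\<alpha> u) (\<alpha> v) = \<bar>u - v\<bar>" if "u \<in> {sa..sb}" "v \<in> {sa..sb}" for u v
    using \<alpha> s that by (auto simp: isometry_def)
  have xpt: "\<alpha> x \<in> points G" using \<alpha> s by (auto simp: isometry_def)
  obtain S where S: "\<forall>(p, \<sigma>, q) \<in> S. strict_shortcut G c p \<sigma> q \<and> path_length \<sigma> \<le> m"
    "eps_dense (cycle_dist G c) \<epsilon> (\<Union>(p, \<sigma>, q) \<in> S. {p, q}) (cycle_trace G c)"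
    using chordal c(1) True unfolding densely_path_chordal_def by blast
  have "\<alpha> x \<in> cycle_trace G c" using c s by auto
  then obtain a where a: "a \<in> (\<Union>(p, \<sigma>, q) \<in> S. {p, q})" "cycle_dist G c a (\<alpha> x) < \<epsilon>" "a \<in> cycle_trace G c"
    using S(2) unfolding eps_dense_def by blast
  have "graph_dist G a (\<alpha> x) < \<epsilon>"
    using graph_dist_le_cycle_dist[OF c(1) a(3) \<open>\<alpha> x \<in> cycle_trace G c\<close>] a(2) by simp
  moreover obtain p \<sigma> q where pq: "(p, \<sigma>, q) \<in> S" "a = p \<or> a = q" using a(1) by auto
  then have sc: "shortcut G c p \<sigma> q" "path_length \<sigma> \<le> m"
    using S(1) by (auto simp: strict_shortcut_def)
  then have path: "is_path G p \<sigma> q" "path_length \<sigma> < cycle_dist G c p q"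
    and tr: "p \<in> cycle_trace G c" "q \<in> cycle_trace G c" by (auto simp: shortcut_def)
  have pts: "p \<in> points G" "q \<in> points G" using is_path_points[OF path(1)] by auto
  have pqm: "graph_dist G p q \<le> m" using graph_dist_le[OF path(1)] sc(2) by simp
  \<comment> \<open>One of \<open>p\<close>, \<open>q\<close> is the dense point \<open>a\<close>
    within \<open>\<epsilon>\<close>; the other is at most \<open>m\<close> further away.\<close>
  ultimately have near: "graph_dist G (\<alpha> x) p \<le> \<epsilon> + m" "graph_dist G (\<alpha> x) q \<le> \<epsilon> + m"
    using graph_dist_triangle[OF xpt pts] graph_dist_triangle[OF xpt pts(2,1)]
      graph_dist_sym[OF xpt pts(1)] graph_dist_sym[OF xpt pts(2)] graph_dist_sym[OF pts] pq(2) pos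
    by auto
  \<comment> \<open>Between two points of the arc, the subarc is a geodesic inside the cycle, so no
    path is shorter than their \<open>cycle_dist\<close>.\<close>
  have "\<not> (p \<in> \<alpha> ` {sa..sb} \<and> q \<in> \<alpha> ` {sa..sb})"
  proof
    assume "p \<in> \<alpha> ` {sa..sb} \<and> q \<in> \<alpha> ` {sa..sb}"
    then obtain u v where uv: "u \<in> {sa..sb}" "v \<in> {sa..sb}" "p = \<alpha> u" "q = \<alpha> v" by auto
    then have "u \<in> {0..l}" "v \<in> {0..l}" using s by auto
    then obtain \<tau> where \<tau>: "is_path G p \<tau> q" "path_length \<tau> = \<bar>u - v\<bar>"
      "path_trace G p \<tau> = \<alpha> ` {min u v..max u v}"
      unfolding uv(3,4) by (rule isometry_path[OF \<alpha>])
    have "{min u v..max u v} \<subseteq> {sa..sb}" using uv by auto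
    then have "path_trace G p \<tau> \<subseteq> cycle_trace G c" using \<tau>(3) c(2) by blast
    then have "cycle_dist G c p q \<le> \<bar>u - v\<bar>"
      using length_dist_le[OF \<tau>(1)] \<tau>(2) by (simp add: cycle_dist_def)
    also have "\<dots> \<le> path_length \<sigma>" using dist[OF uv(1,2)] graph_dist_le[OF path(1)] uv by simp
    finally show False using path(2) by simp
  qed
  then have "p \<in> N \<or> q \<in> N" using tr c by auto
  then show ?thesis using near by (meson max.coboundedI2)
qed

lemma geodesic_isometryE:
  assumes "geodesic G x y S"
  obtains \<gamma> l where "isometry G \<gamma> l" "0 \<le> l" "\<gamma> 0 = x" "\<gamma> l = y" "S = \<gamma> ` {0..l}"
  using assms unfolding geodesic_def isometry_def by metis

lemma side_in_neighborhood:
  assumes geo: "geodesic G x1 x2 A" "geodesic G x2 x3 B" "geodesic G x3 x1 C"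
    and chordal: "densely_path_chordal G \<epsilon> k m" and pos: "0 < \<epsilon>" "0 \<le> m"
  shows "A \<subseteq> neighborhood G (max (k / 4) (\<epsilon> + m)) (B \<union> C)"
proof
  fix z assume "z \<in> A"
  obtain \<alpha> l where \<alpha>: "isometry G \<alpha> l" "0 \<le> l" "\<alpha> 0 = x1" "\<alpha> l = x2" "A = \<alpha> ` {0..l}"
    using geodesic_isometryE[OF geo(1)] .
  obtain \<beta> lb where \<beta>: "isometry G \<beta> lb" "0 \<le> lb" "\<beta> 0 = x2" "\<beta> lb = x3" "B = \<beta> ` {0..lb}"
    using geodesic_isometryE[OF geo(2)] .
  obtain \<zeta> lc where \<zeta>: "isometry G \<zeta> lc" "0 \<le> lc" "\<zeta> 0 = x3" "\<zeta> lc = x1" "C = \<zeta> ` {0..lc}"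
    using geodesic_isometryE[OF geo(3)] .
  \<comment> \<open>\<open>C\<close> is reversed so that both other sides end at
    \<open>x3\<close>.\<close>
  define \<eta> where "\<eta> = (\<lambda>w. \<zeta> (lc - w))"
  have "\<eta> ` {0..lc} = \<zeta> ` (\<lambda>w. lc - w) ` {0..lc}" unfolding \<eta>_def by (simp only: image_image)
  then have \<eta>: "isometry G \<eta> lc" "\<eta> lc = x3" "C = \<eta> ` {0..lc}"
    using isometry_reverse[OF \<zeta>(1)] \<zeta>(3,5) by (simp_all add: \<eta>_def)
  have BC: "B \<union> C \<subseteq> points G" using \<beta> \<zeta> by (auto simp: isometry_def)
  have zpt: "z \<in> points G" using \<open>z \<in> A\<close> \<alpha> by (auto simp: isometry_def)
  have "\<exists>y \<in> B \<union> C. graph_dist G z y \<le> max (k / 4) (\<epsilon> + m)"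
  proof (cases "z \<in> B \<union> C")
    case True
    then show ?thesis using graph_dist_refl[OF zpt] pos by (intro bexI[of _ z]) auto
  next
    case False
    obtain x where x: "x \<in> {0..l}" "z = \<alpha> x" using \<open>z \<in> A\<close> \<alpha> by auto
    define K where "K = {w \<in> {0..l}. \<alpha> w \<in> B} \<union> {w \<in> {0..l}. \<alpha> w \<in> C}"
    have K: "closed K"
      unfolding K_def
      using closed_preimage_of_isometry_image[OF \<alpha>(1) \<beta>(1,2)]
        closed_preimage_of_isometry_image[OF \<alpha>(1) \<zeta>(1,2)] \<beta>(5) \<zeta>(5) by (intro closed_Un) auto
    \<comment> \<open>The ends of \<open>A\<close> lie on the other sides, so the search for
      \<open>K\<close> from \<open>x\<close> succeeds in both directions.\<close>
    have "x1 \<in> C" "x2 \<in> B"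
      unfolding \<beta>(5) \<zeta>(5) using \<beta>(2,3) \<zeta>(2,4) by (metis atLeastAtMost_iff imageI order_refl)+
    then have ends: "0 \<in> {0..x} \<inter> K" "l \<in> {x..l} \<inter> K" using \<alpha>(2-4) x(1) by (auto simp: K_def)
    have "compact ({0..x} \<inter> K)" "compact ({x..l} \<inter> K)"
      using K by (rule compact_Int_closed[OF compact_Icc])+
    then obtain sa sb where sa: "sa \<in> {0..x} \<inter> K" "\<forall>w \<in> {0..x} \<inter> K. w \<le> sa"
      and sb: "sb \<in> {x..l} \<inter> K" "\<forall>w \<in> {x..l} \<inter> K. sb \<le> w"
      using compact_attains_sup[of "{0..x} \<inter> K"] compact_attains_inf[of "{x..l} \<inter> K"] ends by blast
    have "sa \<noteq> x" "sb \<noteq> x" using False x(2) sa(1) sb(1) by (auto simp: K_def)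
    then have s: "0 \<le> sa" "sa < x" "x < sb" "sb \<le> l" using sa(1) sb(1) by auto
    have avoid: "\<alpha> w \<notin> B \<union> C" if "sa < w" "w < sb" for w
    proof
      assume "\<alpha> w \<in> B \<union> C"
      then have "w \<in> K" using that s by (auto simp: K_def)
      then show False
        using bspec[OF sa(2), of w] bspec[OF sb(2), of w] that s \<open>w \<in> K\<close> by (cases "w \<le> x") auto
    qed
    have ab: "\<alpha> sa \<in> B \<union> C" "\<alpha> sb \<in> B \<union> C" using sa(1) sb(1) by (auto simp: K_def)
    \<comment> \<open>Each end of the arc gets a side through it, directed to \<open>x3\<close>;
      this treats all positions of the two ends on \<open>B\<close> and \<open>C\<close>
      uniformly.\<close>
    have "\<exists>\<theta> l'. isometry G \<theta> l' \<and> 0 \<le> l' \<and> \<theta> l' = x3 \<and> y \<in> \<theta> ` {0..l'} \<and> \<theta> ` {0..l'} \<subseteq> B \<union> C"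
      if "y \<in> B \<union> C" for y
    proof (cases "y \<in> B")
      case True
      then show ?thesis using \<beta> by (intro exI[of _ \<beta>] exI[of _ lb]) auto
    next
      case False
      then show ?thesis using that \<eta> \<zeta>(2) by (intro exI[of _ \<eta>] exI[of _ lc]) auto
    qed
    then obtain \<phi> lp \<psi> lq where \<phi>: "isometry G \<phi> lp" "0 \<le> lp" "\<phi> lp = x3" "\<alpha> sa \<in> \<phi> ` {0..lp}" "\<phi> ` {0..lp} \<subseteq> B \<union> C"
      and \<psi>: "isometry G \<psi> lq" "0 \<le> lq" "\<psi> lq = x3" "\<alpha> sb \<in> \<psi> ` {0..lq}" "\<psi> ` {0..lq} \<subseteq> B \<union> C"
      using ab by metis
    have av: "\<alpha> w \<notin> \<phi> ` {0..lp} \<union> \<psi> ` {0..lq}" if "sa < w" "w < sb" for w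
      using avoid[OF that] \<phi>(5) \<psi>(5) by blast
    obtain c N where c: "is_cycle G c" "cycle_trace G c = \<alpha> ` {sa..sb} \<union> N"
      "N \<subseteq> \<phi> ` {0..lp} \<union> \<psi> ` {0..lq}" "2 * (sb - sa) \<le> path_length c"
      using simple_triangle_cycle[OF \<alpha>(1) \<phi>(1) \<psi>(1) s(1) _ s(4) \<psi>(2) _ \<phi>(4) \<psi>(4) av]
        \<phi>(3) \<psi>(3) s by auto
    have "N \<subseteq> B \<union> C" using c(3) \<phi>(5) \<psi>(5) by blast
    then show ?thesis
      using near_triangle_sides[OF chordal \<alpha>(1) s ab c(1,2) _ BC c(4) pos] x(2) by blast
  qed
  then show "z \<in> neighborhood G (max (k / 4) (\<epsilon> + m)) (B \<union> C)"
    using zpt by (simp add: neighborhood_def)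
qed

text \<open>The sides can be permuted cyclically, so the estimate for one side gives all three
  inclusions.\<close>

lemma hyperbolic_of_densely_path_chordal:
  assumes "densely_path_chordal G \<epsilon> k m" "0 < \<epsilon>" "0 \<le> m"
  shows "hyperbolic G (max (k / 4) (\<epsilon> + m))"
  unfolding hyperbolic_def geodesic_triangle_def thin_def
  using side_in_neighborhood[OF _ _ _ assms] by blast

end

theorem theorem2p4:
  fixes G :: "('v, 'e) mgraph" and \<epsilon> k m :: real
  assumes "metric_graph G" and "connected_graph G" and "locally_finite G"
    and "\<epsilon> > 0" and "k \<ge> 0" and "m \<ge> 0"
    and "densely_path_chordal G \<epsilon> k m"
  shows "(\<exists>\<delta>\<ge>0. hyperbolic G \<delta>) \<and> hyperbolicity_constant G \<le> ereal (max (k / 4) (\<epsilon> + m))"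
proof -
  interpret locally_finite_metric_graph G by unfold_locales (use assms in auto)
  have hyp: "hyperbolic G (max (k / 4) (\<epsilon> + m))"
    using hyperbolic_of_densely_path_chordal assms by blast
  moreover have "0 \<le> max (k / 4) (\<epsilon> + m)" using assms by simp
  moreover have "hyperbolicity_constant G \<le> ereal (max (k / 4) (\<epsilon> + m))"
    unfolding hyperbolicity_constant_def using hyp by (intro Inf_lower imageI) simp
  ultimately show ?thesis by blast
qed

end
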